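(* Let $F(z)=\sum_{k=0}^\infty b_k z^k\in\mathcal{B}$ and let \[ R=\frac{1}{4\sqrt3}\sqrt{59-\sqrt{2713}}. \] Then for all $r$ with $R\le r\le 1/\sqrt3$, \[ (1-|b_1|^2)\sum_{k=1}^\infty k|b_k|^2r^{2k}\le \frac{27}{8}r^4. \] The inequality is sharp: equality holds for $F(z)=\frac{3\sqrt3}{4}z^2$.
   Context: $\mathbb{D}$ denotes the open unit disc. $\mathcal{B}$ is the class of functions $F$ analytic in $\mathbb{D}$ satisfying $|F'(z)|\le \frac{1}{1-|z|^2}$ for all $z\in\mathbb{D}$. For $F\in\mathcal{B}$ we write its Taylor expansion as $F(z)=\sum_{k=0}^\infty b_k z^k$. *)

theory Defs
  imports "HOL-Complex_Analysis.Complex_Analysis"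
begin

definition bloch_class :: "(complex \<Rightarrow> complex) set" where
  "bloch_class = {F. F holomorphic_on ball 0 1 \<and>
      (\<forall>z\<in>ball 0 1. norm (deriv F z) \<le> 1 / (1 - (norm z)^2))}"

definition taylor_coeff :: "(complex \<Rightarrow> complex) \<Rightarrow> nat \<Rightarrow> complex" where
  "taylor_coeff F k = (deriv ^^ k) F 0 / of_nat (fact k)"

definition bloch_sum :: "(complex \<Rightarrow> complex) \<Rightarrow> real \<Rightarrow> real" where
  "bloch_sum F r = (1 - (norm (taylor_coeff F 1))^2) *
      (\<Sum>k. real (Suc k) * (norm (taylor_coeff F (Suc k)))^2 * r ^ (2 * Suc k))"

end

theory Submission
  imports Defs
begin

text \<open>
  Put \<open>g(Z) = (2/3) F'(Z / sqrt 3)\<close> and \<open>s = 3 r^2\<close>. The claim becomes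
  \<open>(1 - (9/4) |g_0|^2) * (SUM k. |g_k|^2 s^k / (k+1)) \<le> s/2\<close>, and since the left-hand side is convex in
  \<open>s\<close> it suffices to treat \<open>s = 1\<close> and the critical value \<open>s = 3 R^2\<close>, a root of \<open>8 s^2 - 59 s + 24\<close>.

  After rotations \<open>g_0 = - 3q(1 - 3q^2)\<close> and \<open>g_1 \<ge> 0\<close>. The Bloch class is invariant under disc automorphisms,
  and a suitable one gives \<open>g(Z) = G(W) (1 - 3q^2)/(1 - qZ)^2\<close> with \<open>W = (Z - 3q)/(1 - qZ)\<close>, where \<open>G\<close> is a
  self-map of the unit disc that fixes \<open>-3q\<close>. By the Schwarz lemma its derivative there is \<open>1 - e\<close> with
  \<open>e \<ge> 0\<close>, which bounds \<open>g_1\<close>; the competitor \<open>G(W) = W\<close>, a Moebius translate of \<open>z^2\<close>, has \<open>e = 0\<close>, and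
  \<open>8 s^2 - 59 s + 24\<close> is, up to a positive factor, the \<open>q^2\<close>-coefficient of the claim for it.

  If \<open>q\<close> or \<open>e/q^2\<close> is not small, the bound on \<open>g_1\<close> and \<open>SUM k. |g_k|^2 \<le> 1\<close> already suffice. Otherwise
  \<open>G\<close> is within \<open>O(e)\<close> of the identity on compact sets, so all coefficients of \<open>g\<close> are known up to \<open>O(e)\<close>; the
  terms of order \<open>q^2\<close> cancel at the critical value, the gain in \<open>|g_1|^2\<close> absorbs the terms linear in \<open>e\<close>, and
  the terms of order \<open>q^4\<close> have the right sign.
\<close>

section \<open>Taylor coefficients\<close>

lemma has_fps_expansion_imp_taylor_coeff: "f has_fps_expansion F \<Longrightarrow> taylor_coeff f k = fps_nth F k"
  by (simp add: taylor_coeff_def fps_nth_fps_expansion)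

lemma taylor_coeff_0: "taylor_coeff f 0 = f 0"
  by (simp add: taylor_coeff_def)

lemma taylor_coeff_Suc: "taylor_coeff f (Suc k) = taylor_coeff (deriv f) k / of_nat (Suc k)"
  by (simp add: taylor_coeff_def funpow_Suc_right algebra_simps del: funpow.simps)

lemma taylor_coeff_add:
  assumes "f holomorphic_on S" "g holomorphic_on S" "open S" "0 \<in> S"
  shows "taylor_coeff (\<lambda>z. f z + g z) k = taylor_coeff f k + taylor_coeff g k"
  using higher_deriv_add[OF assms] by (simp add: taylor_coeff_def add_divide_distrib)

lemma taylor_coeff_scale:
  assumes f: "f holomorphic_on ball 0 R" and "0 < R" and d: "d \<noteq> 0"
  shows "taylor_coeff (\<lambda>z. b * f (d * z)) k = b * d ^ k * taylor_coeff f k"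
proof -
  let ?S = "ball 0 (R / norm d)"
  have mult_d_mem: "d * z \<in> ball 0 R" if "z \<in> ?S" for z
    using that d by (simp add: norm_mult field_simps)
  have "(\<lambda>z. f (d * z)) holomorphic_on ?S"
    using mult_d_mem by (intro holomorphic_on_compose_gen[OF _ f, unfolded o_def] holomorphic_intros) auto
  hence "(deriv ^^ k) (\<lambda>z. b * f (d * z)) 0 = b * (deriv ^^ k) (\<lambda>z. f (d * z)) 0"
    using d \<open>0 < R\<close> by (intro higher_deriv_cmult) auto
  also have "(deriv ^^ k) (\<lambda>z. f (d * z)) 0 = d ^ k * (deriv ^^ k) f (d * 0)"
    using d mult_d_mem \<open>0 < R\<close> by (intro higher_deriv_compose_linear[OF f, of ?S]) auto
  finally show ?thesis by (simp add: taylor_coeff_def)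
qed

lemma taylor_coeff_mult_power_eq_0:
  assumes "f holomorphic_on ball 0 R" "0 < R" "k < m"
  shows "taylor_coeff (\<lambda>z. z ^ m * f z) k = 0"
proof -
  have "f has_fps_expansion fps_expansion f 0"
    using assms by (intro has_fps_expansion_fps_expansion[of "ball 0 R"]) auto
  hence "(\<lambda>z. z ^ m * f z) has_fps_expansion fps_X ^ m * fps_expansion f 0"
    by (intro fps_expansion_intros)
  thus ?thesis
    using \<open>k < m\<close> by (simp add: has_fps_expansion_imp_taylor_coeff fps_X_power_mult_nth)
qed

lemma taylor_coeff_monom: "taylor_coeff (\<lambda>z. b * z ^ m) k = (if k = m then b else 0)"
proof -
  have "(\<lambda>z. b * z ^ m) has_fps_expansion fps_const b * fps_X ^ m"
    by (intro fps_expansion_intros)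
  thus ?thesis by (simp add: has_fps_expansion_imp_taylor_coeff)
qed

lemma taylor_coeff_quadratic:
  "taylor_coeff (\<lambda>z. a + b * z + c * z\<^sup>2) k
      = (if k = 0 then a else if k = 1 then b else if k = 2 then c else 0)"
proof -
  have "(\<lambda>z. a + b * z + c * z\<^sup>2) has_fps_expansion
      fps_const a + fps_const b * fps_X + fps_const c * fps_X\<^sup>2"
    by (intro fps_expansion_intros)
  thus ?thesis by (simp add: has_fps_expansion_imp_taylor_coeff)
qed

lemma norm_taylor_coeff_le:
  assumes f: "f holomorphic_on ball 0 R" and "0 < \<rho>" "\<rho> < R"
    and norm_f_le: "\<And>z. norm z = \<rho> \<Longrightarrow> norm (f z) \<le> M"
  shows "norm (taylor_coeff f k) \<le> M / \<rho> ^ k"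
proof -
  have "norm ((deriv ^^ k) f 0) \<le> fact k * M / \<rho> ^ k"
  proof (rule Cauchy_inequality)
    show "f holomorphic_on ball 0 \<rho>"
      using \<open>\<rho> < R\<close> by (intro holomorphic_on_subset[OF f] subset_ball) simp
    show "continuous_on (cball 0 \<rho>) f"
      using \<open>\<rho> < R\<close> by (intro holomorphic_on_imp_continuous_on holomorphic_on_subset[OF f]) auto
  qed (use \<open>0 < \<rho>\<close> norm_f_le in auto)
  thus ?thesis by (simp add: taylor_coeff_def norm_divide divide_le_eq mult.commute)
qed

lemma taylor_coeff_sums:
  assumes "f holomorphic_on ball 0 R" "norm z < R"
  shows "(\<lambda>k. taylor_coeff f k * z ^ k) sums f z"
  using holomorphic_power_series[OF assms(1), of z] assms(2) by (simp add: taylor_coeff_def)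

lemma uniform_limit_taylor_coeff:
  assumes f: "f holomorphic_on ball 0 R" and "0 \<le> \<rho>" "\<rho> < R"
  shows "uniform_limit (cball 0 \<rho>) (\<lambda>n z. \<Sum>k<n. taylor_coeff f k * z ^ k) f sequentially"
proof -
  obtain t where t: "\<rho> < t" "t < R" using \<open>\<rho> < R\<close> dense by blast
  have "summable (\<lambda>k. taylor_coeff f k * of_real t ^ k)"
    using taylor_coeff_sums[OF f, of "of_real t"] t \<open>0 \<le> \<rho>\<close> by (auto simp: sums_iff)
  hence "ereal t \<le> conv_radius (taylor_coeff f)"
    using conv_radius_geI[of "taylor_coeff f" "of_real t"] t \<open>0 \<le> \<rho>\<close> by simp
  hence "ereal \<rho> < conv_radius (taylor_coeff f)"
    using t(1) by (meson ereal_less(1) less_ereal.simps(1) order_less_le_trans)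
  from powser_uniform_limit[OF this, of 0]
  have "uniform_limit (cball 0 \<rho>) (\<lambda>n z. \<Sum>k<n. taylor_coeff f k * z ^ k)
      (\<lambda>z. \<Sum>k. taylor_coeff f k * z ^ k) sequentially"
    by simp
  moreover have "(\<Sum>k. taylor_coeff f k * z ^ k) = f z" if "z \<in> cball 0 \<rho>" for z
    using taylor_coeff_sums[OF f, of z] that \<open>\<rho> < R\<close> by (simp add: sums_iff)
  ultimately show ?thesis
    by (metis (no_types, lifting) uniform_limit_cong')
qed

lemma sum_root_of_unity_quotient_powers:
  fixes k l N :: nat
  assumes "k < N" "l < N"
  defines "w \<equiv> exp (2 * of_real pi * \<i> / of_nat N)"
  shows "(\<Sum>j<N. (w ^ k / w ^ l) ^ j) = (if k = l then of_nat N else 0)"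
proof (cases "k = l")
  case True
  then show ?thesis by (simp add: w_def)
next
  case False
  have "1 \<le> N" using \<open>k < N\<close> by simp
  have [simp]: "w \<noteq> 0" by (simp add: w_def)
  have w_power: "w ^ j = exp (2 * of_real pi * \<i> * of_nat j / of_nat N)" for j
    unfolding w_def by (simp flip: exp_of_nat_mult add: field_simps)
  hence "w ^ N = 1" using \<open>1 \<le> N\<close> by simp
  hence "(w ^ k / w ^ l) ^ N = 1"
    by (simp add: power_divide power_commutes flip: power_mult)
      (simp add: power_mult mult.commute[of _ N])
  moreover have "w ^ k / w ^ l \<noteq> 1"
    using False \<open>k < N\<close> \<open>l < N\<close> complex_root_unity_eq[OF \<open>1 \<le> N\<close>, of k l]
    by (simp add: w_power divide_eq_1_iff)
  ultimately show ?thesis using False by (simp add: sum_gp_strict)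
qed

lemma parseval_roots_of_unity:
  fixes N :: nat and b :: "nat \<Rightarrow> complex"
  defines "w \<equiv> exp (2 * of_real pi * \<i> / of_nat N)"
  shows "(\<Sum>j<N. (norm (\<Sum>k<N. b k * (w ^ j) ^ k))\<^sup>2) = real N * (\<Sum>k<N. (norm (b k))\<^sup>2)"
proof -
  have cnj_w: "cnj w = inverse w"
    by (simp add: w_def exp_cnj exp_minus flip: exp_minus)
  have "complex_of_real (\<Sum>j<N. (norm (\<Sum>k<N. b k * (w ^ j) ^ k))\<^sup>2) =
        (\<Sum>j<N. \<Sum>k<N. \<Sum>l<N. b k * cnj (b l) * (w ^ k / w ^ l) ^ j)"
    unfolding of_real_sum complex_norm_square cnj_sum sum_product
    by (simp add: cnj_w mult_ac power_mult_distrib divide_inverse power_inverse flip: power_mult)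
  also have "\<dots> = (\<Sum>k<N. \<Sum>l<N. \<Sum>j<N. b k * cnj (b l) * (w ^ k / w ^ l) ^ j)"
    by (subst sum.swap, rule sum.cong[OF refl], rule sum.swap)
  also have "\<dots> = (\<Sum>k<N. \<Sum>l<N. b k * cnj (b l) * (if k = l then of_nat N else 0))"
    unfolding sum_distrib_left[symmetric] w_def
    by (intro sum.cong refl) (simp only: lessThan_iff sum_root_of_unity_quotient_powers)
  also have "\<dots> = (\<Sum>k<N. of_nat N * (b k * cnj (b k)))"
    by (intro sum.cong refl) (simp add: if_distrib sum.delta mult_ac cong: if_cong)
  also have "\<dots> = complex_of_real (real N * (\<Sum>k<N. (norm (b k))\<^sup>2))"
    by (simp only: of_real_mult of_real_sum complex_norm_square sum_distrib_left of_real_of_nat_eq)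
  finally show ?thesis by (simp only: of_real_eq_iff)
qed

lemma sum_norm_coeff_square_le:
  fixes b :: "nat \<Rightarrow> complex"
  assumes "0 \<le> \<rho>" and norm_sum_le: "\<And>z. norm z = \<rho> \<Longrightarrow> norm (\<Sum>k<N. b k * z ^ k) \<le> M"
  shows "(\<Sum>k<N. (norm (b k))\<^sup>2 * \<rho> ^ (2 * k)) \<le> M\<^sup>2"
proof (cases "N = 0")
  case False
  define w where "w = exp (2 * of_real pi * \<i> / of_nat N)"
  have "norm (w ^ j) = 1" for j
    by (simp add: w_def norm_power norm_exp_eq_Re)
  hence norm_sum_le_M: "norm (\<Sum>k<N. b k * (of_real \<rho> * w ^ j) ^ k) \<le> M" for j
    using \<open>0 \<le> \<rho>\<close> by (intro norm_sum_le) (simp add: norm_mult)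
  have "real N * (\<Sum>k<N. (norm (b k))\<^sup>2 * \<rho> ^ (2 * k)) = real N * (\<Sum>k<N. (norm (b k * of_real \<rho> ^ k))\<^sup>2)"
    using \<open>0 \<le> \<rho>\<close>
    by (simp add: norm_mult norm_power power_mult_distrib mult.commute[of 2] flip: power_mult)
  also have "\<dots> = (\<Sum>j<N. (norm (\<Sum>k<N. b k * (of_real \<rho> * w ^ j) ^ k))\<^sup>2)"
    using parseval_roots_of_unity[where N = N and b = "\<lambda>k. b k * of_real \<rho> ^ k"]
    by (simp add: w_def power_mult_distrib mult_ac)
  also have "\<dots> \<le> (\<Sum>j<N. M\<^sup>2)"
    by (intro sum_mono power_mono norm_sum_le_M norm_ge_zero)
  finally show ?thesis using False by simp
qed simp

lemma taylor_coeff_bessel: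
  assumes f: "f holomorphic_on ball 0 R" and \<rho>: "0 \<le> \<rho>" "\<rho> < R"
    and norm_f_le: "\<And>z. norm z = \<rho> \<Longrightarrow> norm (f z) \<le> M"
  shows "(\<Sum>k<n. (norm (taylor_coeff f k))\<^sup>2 * \<rho> ^ (2 * k)) \<le> M\<^sup>2"
proof (rule tendsto_lowerbound)
  show "((\<lambda>\<epsilon>. (M + \<epsilon>)\<^sup>2) \<longlongrightarrow> M\<^sup>2) (at_right 0)"
    by (auto intro!: tendsto_eq_intros)
  have "(\<Sum>k<n. (norm (taylor_coeff f k))\<^sup>2 * \<rho> ^ (2 * k)) \<le> (M + \<epsilon>)\<^sup>2" if "0 < \<epsilon>" for \<epsilon>
  proof -
    obtain N where "n \<le> N"
      and dist_less: "\<And>z. norm z \<le> \<rho> \<Longrightarrow> dist (\<Sum>k<N. taylor_coeff f k * z ^ k) (f z) < \<epsilon>"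
      using eventually_happens'[OF sequentially_bot eventually_conj[OF eventually_ge_at_top[of n]
            uniform_limitD[OF uniform_limit_taylor_coeff[OF f \<rho>] \<open>0 < \<epsilon>\<close>]]]
      by auto
    have "(\<Sum>k<n. (norm (taylor_coeff f k))\<^sup>2 * \<rho> ^ (2 * k))
        \<le> (\<Sum>k<N. (norm (taylor_coeff f k))\<^sup>2 * \<rho> ^ (2 * k))"
      using \<open>n \<le> N\<close> \<rho> by (intro sum_mono2) auto
    also have "\<dots> \<le> (M + \<epsilon>)\<^sup>2"
    proof (rule sum_norm_coeff_square_le[OF \<rho>(1)])
      fix z :: complex assume "norm z = \<rho>"
      thus "norm (\<Sum>k<N. taylor_coeff f k * z ^ k) \<le> M + \<epsilon>"
        using dist_less[of z] norm_f_le[of z] norm_triangle_sub[of "\<Sum>k<N. taylor_coeff f k * z ^ k" "f z"]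
        by (simp add: dist_norm)
    qed
    finally show ?thesis .
  qed
  thus "\<forall>\<^sub>F \<epsilon> in at_right 0. (\<Sum>k<n. (norm (taylor_coeff f k))\<^sup>2 * \<rho> ^ (2 * k)) \<le> (M + \<epsilon>)\<^sup>2"
    by (simp add: eventually_at_right_less eventually_at_right_field) (meson less_numeral_extra(1))
qed simp

section \<open>Self-maps of the unit disc\<close>

lemma norm_le_of_Re_pos:
  assumes f: "f holomorphic_on ball 0 1" and pos: "\<And>z. norm z < 1 \<Longrightarrow> 0 < Re (f z)" and z: "norm z < 1"
  shows "norm (f z) \<le> norm (f 0) * ((1 + norm z) / (1 - norm z))"
proof -
  define k where "k z = (f z - f 0) / (f z + cnj (f 0))" for z
  have Re_f0: "0 < Re (f 0)" using pos[of 0] by simp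
  have denom_nonzero: "f z + cnj (f 0) \<noteq> 0" if "norm z < 1" for z
    using pos[OF that] Re_f0 by (auto simp: complex_eq_iff)
  have k_le: "norm (k z) \<le> norm z"
  proof (rule Schwarz_Lemma(1)[OF _ _ _ z])
    show "k holomorphic_on ball 0 1"
      unfolding k_def using f denom_nonzero by (intro holomorphic_intros) auto
    show "k 0 = 0" by (simp add: k_def)
    fix z :: complex assume z: "norm z < 1"
    have "(norm (f z + cnj (f 0)))\<^sup>2 - (norm (f z - f 0))\<^sup>2 = 4 * (Re (f z) * Re (f 0))"
      unfolding cmod_power2 by (simp add: power2_eq_square algebra_simps)
    hence "(norm (f z - f 0))\<^sup>2 < (norm (f z + cnj (f 0)))\<^sup>2"
      using mult_pos_pos[OF pos[OF z] Re_f0] by linarith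
    hence "norm (f z - f 0) < norm (f z + cnj (f 0))"
      by (rule power2_less_imp_less) simp
    thus "norm (k z) < 1"
      by (simp add: k_def norm_divide divide_less_eq_1)
  qed
  have "norm (f z) - norm (f 0) \<le> norm (f z - f 0)"
    by (rule norm_triangle_ineq2)
  also have "\<dots> = norm (k z) * norm (f z + cnj (f 0))"
    using denom_nonzero[OF z] by (simp add: k_def norm_divide)
  also have "\<dots> \<le> norm z * (norm (f z) + norm (f 0))"
    using k_le norm_triangle_ineq[of "f z" "cnj (f 0)"] by (intro mult_mono) auto
  finally have "norm (f z) * (1 - norm z) \<le> norm (f 0) * (1 + norm z)" by (simp add: algebra_simps)
  thus ?thesis using z by (simp add: field_simps)
qed

lemma norm_le_of_Re_nonneg:
  assumes f: "f holomorphic_on ball 0 1" and nonneg: "\<And>z. norm z < 1 \<Longrightarrow> 0 \<le> Re (f z)" and z: "norm z < 1"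
  shows "norm (f z) \<le> norm (f 0) * ((1 + norm z) / (1 - norm z))"
proof (rule tendsto_le)
  let ?C = "(1 + norm z) / (1 - norm z)"
  have "norm (f z + of_real \<epsilon>) \<le> norm (f 0 + of_real \<epsilon>) * ?C" if "0 < \<epsilon>" for \<epsilon>
    using that nonneg
    by (intro norm_le_of_Re_pos[OF _ _ z] holomorphic_intros f) (simp add: add_nonneg_pos)
  thus "\<forall>\<^sub>F \<epsilon> in at_right 0. norm (f z + of_real \<epsilon>) \<le> norm (f 0 + of_real \<epsilon>) * ?C"
    by (auto simp: eventually_at_right_field intro!: exI[of _ 1])
  show "((\<lambda>\<epsilon>. norm (f 0 + of_real \<epsilon>) * ?C) \<longlongrightarrow> norm (f 0) * ?C) (at_right 0)"
    and "((\<lambda>\<epsilon>. norm (f z + of_real \<epsilon>)) \<longlongrightarrow> norm (f z)) (at_right 0)"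
    using z by (auto intro!: tendsto_eq_intros)
qed simp

lemma Moebius_function_denom_nonzero:
  assumes "norm w < 1" "norm z < 1"
  shows "1 - cnj w * z \<noteq> 0"
proof
  assume "1 - cnj w * z = 0"
  hence "norm (w * z) = 1" by (metis complex_mod_cnj eq_iff_diff_eq_0 norm_mult norm_one)
  thus False using norm_mult_less[OF assms] by simp
qed

lemma one_minus_norm_Moebius_function:
  assumes "norm w < 1" "norm z < 1"
  shows "1 - (norm (Moebius_function 0 w z))\<^sup>2
      = (1 - (norm w)\<^sup>2) * (1 - (norm z)\<^sup>2) / (norm (1 - cnj w * z))\<^sup>2"
proof -
  have "(norm (1 - cnj w * z))\<^sup>2 - (norm (z - w))\<^sup>2 = (1 - (norm w)\<^sup>2) * (1 - (norm z)\<^sup>2)"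
    unfolding cmod_power2 by (simp add: power2_eq_square algebra_simps)
  thus ?thesis
    using Moebius_function_denom_nonzero[OF assms]
    by (simp add: Moebius_function_simple norm_divide power_divide divide_simps)
qed

lemma of_real_one_minus_norm_square: "of_real (1 - (norm w)\<^sup>2) = 1 - cnj w * w"
  by (simp only: of_real_diff of_real_1 complex_norm_square mult.commute)

lemma has_field_derivative_Moebius_function:
  assumes "norm w < 1" "norm z < 1"
  shows "(Moebius_function 0 w has_field_derivative
      of_real (1 - (norm w)\<^sup>2) / (1 - cnj w * z)\<^sup>2) (at z)"
  unfolding Moebius_function_simple[abs_def] of_real_one_minus_norm_square
  using Moebius_function_denom_nonzero[OF assms]
  by (auto intro!: derivative_eq_intros simp: power2_eq_square algebra_simps)

lemma Moebius_function_diff: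
  fixes w x y :: complex
  assumes "norm w < 1" "norm x < 1" "norm y < 1"
  shows "Moebius_function 0 w x - Moebius_function 0 w y =
    of_real (1 - (norm w)\<^sup>2) * (x - y) / ((1 - cnj w * x) * (1 - cnj w * y))"
proof -
  have "1 - cnj w * x \<noteq> 0" "1 - cnj w * y \<noteq> 0"
    using assms Moebius_function_denom_nonzero by blast+
  thus ?thesis
    unfolding Moebius_function_simple of_real_one_minus_norm_square
    by (simp add: divide_simps) (simp add: algebra_simps)
qed

lemma norm_Moebius_function_diff_le:
  assumes w: "norm w < 1" and V: "norm x \<le> V" "norm y \<le> V" "V < 1"
  shows "norm (Moebius_function 0 w x - Moebius_function 0 w y)
    \<le> (1 - (norm w)\<^sup>2) * norm (x - y) / (1 - norm w * V)\<^sup>2"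
proof -
  have V_nonneg: "0 \<le> V" using V(1) norm_ge_zero[of x] by linarith
  have nonneg: "0 \<le> 1 - (norm w)\<^sup>2" using w by (simp add: power_le_one)
  have denom_pos: "0 < 1 - norm w * V"
    using mult_mono[of "norm w" 1 V V] w V(3) V_nonneg by simp
  have denom_ge: "1 - norm w * V \<le> norm (1 - cnj w * z)" if "norm z \<le> V" for z
    using norm_triangle_ineq2[of 1 "cnj w * z"] mult_left_mono[OF that, of "norm w"]
    by (simp add: norm_mult)
  have "norm (Moebius_function 0 w x - Moebius_function 0 w y)
      = (1 - (norm w)\<^sup>2) * norm (x - y) / (norm (1 - cnj w * x) * norm (1 - cnj w * y))"
    using w V nonneg
    by (simp only: Moebius_function_diff norm_divide norm_mult norm_of_real abs_of_nonneg)
  also have "\<dots> \<le> (1 - (norm w)\<^sup>2) * norm (x - y) / ((1 - norm w * V) * (1 - norm w * V))"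
    using denom_ge[OF V(1)] denom_ge[OF V(2)] denom_pos nonneg
    by (intro divide_left_mono mult_mono mult_pos_pos) auto
  finally show ?thesis by (simp add: power2_eq_square)
qed

lemma norm_one_minus_le:
  assumes f: "f holomorphic_on ball 0 1" "\<And>z. norm z < 1 \<Longrightarrow> norm (f z) \<le> 1" and z: "norm z < 1"
  shows "norm (1 - f z) \<le> norm (1 - f 0) * ((1 + norm z) / (1 - norm z))"
proof (rule norm_le_of_Re_nonneg[OF _ _ z])
  show "0 \<le> Re (1 - f w)" if "norm w < 1" for w
    using f(2)[OF that] complex_Re_le_cmod[of "f w"] by simp
qed (intro holomorphic_intros f(1))

lemma Schwarz_factorization:
  assumes f: "f holomorphic_on ball 0 1" and "f 0 = 0" and norm_f_less_1: "\<And>z. norm z < 1 \<Longrightarrow> norm (f z) < 1"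
  obtains h where "h holomorphic_on ball 0 1" "\<And>z. norm z < 1 \<Longrightarrow> f z = z * h z"
    "\<And>z. norm z < 1 \<Longrightarrow> norm (h z) \<le> 1" "h 0 = deriv f 0"
proof -
  obtain h where h: "h holomorphic_on ball 0 1" "\<And>z. norm z < 1 \<Longrightarrow> f z = z * h z" "deriv f 0 = h 0"
    using Schwarz3[OF f \<open>f 0 = 0\<close>] by blast
  have "norm (h z) \<le> 1" if z: "norm z < 1" for z
  proof (cases "z = 0")
    case True
    then show ?thesis using Schwarz_Lemma(2)[OF f \<open>f 0 = 0\<close> norm_f_less_1 z] h(3) by simp
  next
    case False
    then show ?thesis using Schwarz_Lemma(1)[OF f \<open>f 0 = 0\<close> norm_f_less_1 z] h(2)[OF z] by (simp add: norm_mult)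
  qed
  with h that show thesis by metis
qed

lemma deriv_Moebius_conjugate:
  assumes f: "f holomorphic_on ball 0 1" and p: "norm p < 1" "f p = p"
  shows "deriv (Moebius_function 0 p \<circ> (f \<circ> Moebius_function 0 (-p))) 0 = deriv f p"
proof -
  define a where "a = complex_of_real (1 - (norm p)\<^sup>2)"
  have a_eq: "a = 1 - cnj p * p"
    unfolding a_def by (rule of_real_one_minus_norm_square)
  have "a \<noteq> 0"
    unfolding a_def of_real_eq_0_iff using p abs_square_less_1[of "norm p"] by simp
  have "(Moebius_function 0 (-p) has_field_derivative a) (at 0)"
    using has_field_derivative_Moebius_function[of "-p" 0] p by (simp add: a_def)
  moreover have "(Moebius_function 0 p has_field_derivative a / a\<^sup>2) (at p)"
    using has_field_derivative_Moebius_function[OF p(1) p(1)]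
    by (simp only: a_def[symmetric] a_eq[symmetric])
  moreover have "(f has_field_derivative deriv f p) (at p)"
    using p by (intro holomorphic_derivI[OF f]) auto
  ultimately have "(Moebius_function 0 p \<circ> (f \<circ> Moebius_function 0 (-p))
      has_field_derivative a / a\<^sup>2 * (deriv f p * a)) (at 0)"
    using p by (intro DERIV_chain) (simp_all add: Moebius_function_of_zero)
  thus ?thesis
    using \<open>a \<noteq> 0\<close> by (simp add: DERIV_imp_deriv power2_eq_square)
qed

lemma self_map_fixed_point_factorization:
  assumes f: "f holomorphic_on ball 0 1" "\<And>z. norm z < 1 \<Longrightarrow> norm (f z) < 1"
    and p: "norm p < 1" "f p = p"
  obtains h where "h holomorphic_on ball 0 1" "\<And>v. norm v < 1 \<Longrightarrow> norm (h v) \<le> 1" "h 0 = deriv f p"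
    "\<And>v. norm v < 1 \<Longrightarrow> f (Moebius_function 0 (-p) v) = Moebius_function 0 (-p) (v * h v)"
proof -
  define \<phi> where "\<phi> = Moebius_function 0 p \<circ> (f \<circ> Moebius_function 0 (-p))"
  have M_p: "Moebius_function 0 (-p) 0 = p" by (simp add: Moebius_function_of_zero)
  have M_lt: "norm (Moebius_function 0 (-p) v) < 1" if "norm v < 1" for v
    using Moebius_function_norm_lt_1[of "-p"] p that by simp
  have "\<phi> holomorphic_on ball 0 1"
    unfolding \<phi>_def using f p M_lt
    by (intro holomorphic_on_compose_gen[of _ _ _ "ball 0 1"] Moebius_function_holomorphic) auto
  moreover have "\<phi> 0 = 0"
    by (simp add: \<phi>_def M_p p Moebius_function_eq_zero)
  moreover have "norm (\<phi> v) < 1" if "norm v < 1" for v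
    unfolding \<phi>_def using Moebius_function_norm_lt_1 p f M_lt that by simp
  ultimately obtain h where h: "h holomorphic_on ball 0 1" "\<And>v. norm v < 1 \<Longrightarrow> \<phi> v = v * h v"
      "\<And>v. norm v < 1 \<Longrightarrow> norm (h v) \<le> 1" "h 0 = deriv \<phi> 0"
    using Schwarz_factorization by blast
  have "deriv \<phi> 0 = deriv f p"
    unfolding \<phi>_def by (rule deriv_Moebius_conjugate[OF f(1) p])
  moreover have "\<And>v. norm v < 1 \<Longrightarrow> f (Moebius_function 0 (-p) v) = Moebius_function 0 (-p) (v * h v)"
    using Moebius_function_compose[of "-p" p] p f M_lt h(2) by (simp add: \<phi>_def flip: h(2))
  ultimately show thesis using that[OF h(1) h(3)] h(4) by simp
qed

lemma norm_deriv_fixed_point_le_1: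
  assumes "f holomorphic_on ball 0 1" "\<And>z. norm z < 1 \<Longrightarrow> norm (f z) < 1" "norm p < 1" "f p = p"
  shows "norm (deriv f p) \<le> 1"
proof -
  obtain h :: "complex \<Rightarrow> complex" where h: "\<And>v. norm v < 1 \<Longrightarrow> norm (h v) \<le> 1" "h 0 = deriv f p"
    by (rule self_map_fixed_point_factorization[OF assms]) (auto intro: that)
  show ?thesis using h(1)[of 0] h(2) by simp
qed

lemma norm_self_map_minus_id_le:
  assumes f: "f holomorphic_on ball 0 1" "\<And>z. norm z < 1 \<Longrightarrow> norm (f z) < 1"
    and p: "norm p < 1" "f p = p" and z: "norm z < 1"
    and V: "norm (Moebius_function 0 p z) \<le> V" "V < 1"
  shows "norm (f z - z)
    \<le> (1 - (norm p)\<^sup>2) * (V * (norm (1 - deriv f p) * ((1 + V) / (1 - V)))) / (1 - norm p * V)\<^sup>2"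
proof -
  obtain h where h: "h holomorphic_on ball 0 1" "\<And>v. norm v < 1 \<Longrightarrow> norm (h v) \<le> 1" "h 0 = deriv f p"
    and f_eq: "\<And>v. norm v < 1 \<Longrightarrow> f (Moebius_function 0 (-p) v) = Moebius_function 0 (-p) (v * h v)"
    by (rule self_map_fixed_point_factorization[OF f p]) (auto intro: that)
  define v where "v = Moebius_function 0 p z"
  have v: "norm v \<le> V" "norm v < 1" using V by (auto simp: v_def)
  have V_nonneg: "0 \<le> V" using v(1) norm_ge_zero[of v] by linarith
  have norm_vh_le: "norm (v * h v) \<le> V"
    using mult_mono[OF v(1) h(2)[OF v(2)]] V_nonneg by (simp add: norm_mult)
  have z_eq: "z = Moebius_function 0 (-p) v"
    using p z by (simp add: v_def Moebius_function_compose)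
  have "norm (1 - h v) \<le> norm (1 - h 0) * ((1 + norm v) / (1 - norm v))"
    by (rule norm_one_minus_le[OF h(1,2) v(2)])
  also have "\<dots> \<le> norm (1 - deriv f p) * ((1 + V) / (1 - V))"
    unfolding h(3) using v V V_nonneg by (intro mult_left_mono frac_le) auto
  finally have "norm v * norm (1 - h v) \<le> V * (norm (1 - deriv f p) * ((1 + V) / (1 - V)))"
    using v V_nonneg by (intro mult_mono) auto
  moreover have "v * h v - v = - (v * (1 - h v))" by (simp add: algebra_simps)
  ultimately have norm_diff_le: "norm (v * h v - v) \<le> V * (norm (1 - deriv f p) * ((1 + V) / (1 - V)))"
    by (simp only: norm_minus_cancel norm_mult)
  have "norm (f z - z) \<le> (1 - (norm p)\<^sup>2) * norm (v * h v - v) / (1 - norm p * V)\<^sup>2"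
    using norm_Moebius_function_diff_le[of "-p", OF _ norm_vh_le v(1) V(2)] f_eq[OF v(2)] p(1)
    by (simp flip: z_eq)
  also have "\<dots>
      \<le> (1 - (norm p)\<^sup>2) * (V * (norm (1 - deriv f p) * ((1 + V) / (1 - V)))) / (1 - norm p * V)\<^sup>2"
    using norm_diff_le p(1) by (intro divide_right_mono mult_left_mono) (auto simp: power_le_one)
  finally show ?thesis .
qed

section \<open>Bloch functions\<close>

lemma bloch_classD:
  assumes "F \<in> bloch_class"
  shows "F holomorphic_on ball 0 1" "norm z < 1 \<Longrightarrow> norm (deriv F z) \<le> 1 / (1 - (norm z)\<^sup>2)"
  using assms by (auto simp: bloch_class_def)

lemma deriv_comp_Moebius_function:
  assumes F: "F holomorphic_on ball 0 1" and "norm w < 1" "norm z < 1"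
  shows "deriv (F \<circ> Moebius_function 0 w) z
    = deriv F (Moebius_function 0 w z) * (of_real (1 - (norm w)\<^sup>2) / (1 - cnj w * z)\<^sup>2)"
  using assms Moebius_function_norm_lt_1
  by (intro DERIV_imp_deriv DERIV_chain has_field_derivative_Moebius_function holomorphic_derivI[OF F])
    auto

lemma bloch_class_comp_Moebius_function:
  assumes F: "F \<in> bloch_class" and w: "norm w < 1"
  shows "F \<circ> Moebius_function 0 w \<in> bloch_class"
proof -
  have "norm (deriv (F \<circ> Moebius_function 0 w) z) \<le> 1 / (1 - (norm z)\<^sup>2)" if z: "norm z < 1" for z
  proof -
    define D where "D = 1 - (norm (Moebius_function 0 w z))\<^sup>2"
    define J where "J = (1 - (norm w)\<^sup>2) / (norm (1 - cnj w * z))\<^sup>2"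
    have M_lt: "norm (Moebius_function 0 w z) < 1"
      by (rule Moebius_function_norm_lt_1[OF w z])
    have pos: "0 < D" "0 \<le> J" "0 < 1 - (norm z)\<^sup>2"
      using M_lt w z by (auto simp: D_def J_def power_less_one_iff power_le_one abs_square_less_1)
    have D_eq: "D = J * (1 - (norm z)\<^sup>2)"
      using one_minus_norm_Moebius_function[OF w z] by (simp add: D_def J_def)
    have "norm (deriv (F \<circ> Moebius_function 0 w) z) = norm (deriv F (Moebius_function 0 w z)) * J"
      unfolding deriv_comp_Moebius_function[OF bloch_classD(1)[OF F] w z]
        norm_mult norm_divide norm_power norm_of_real
      using w by (simp add: J_def power_le_one)
    also have "\<dots> \<le> 1 / D * J"
      using bloch_classD(2)[OF F M_lt] pos by (intro mult_right_mono) (auto simp: D_def)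
    also have "\<dots> = 1 / (1 - (norm z)\<^sup>2)"
      using pos by (cases "J = 0") (simp_all add: D_eq)
    finally show ?thesis .
  qed
  moreover have "F \<circ> Moebius_function 0 w holomorphic_on ball 0 1"
    using Moebius_function_norm_lt_1[OF w]
    by (intro holomorphic_on_compose_gen[OF Moebius_function_holomorphic[OF w] bloch_classD(1)[OF F]])
      auto
  ultimately show ?thesis by (simp add: bloch_class_def)
qed

lemma bloch_class_rotate:
  assumes F: "F \<in> bloch_class" and "norm c = 1" "norm d = 1"
  shows "(\<lambda>z. c * F (d * z)) \<in> bloch_class"
proof -
  have "(\<lambda>z. c * F (d * z)) holomorphic_on ball 0 1"
    using assms
    by (intro holomorphic_intros holomorphic_on_compose_gen[OF _ bloch_classD(1)[OF F], unfolded o_def])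
      (auto simp: norm_mult)
  moreover have "norm (deriv (\<lambda>z. c * F (d * z)) z) \<le> 1 / (1 - (norm z)\<^sup>2)" if "norm z < 1" for z
  proof -
    have norm_dz: "norm (d * z) < 1" using that assms by (simp add: norm_mult)
    have "(F has_field_derivative deriv F (d * z)) (at (d * z))"
      using norm_dz by (intro holomorphic_derivI[OF bloch_classD(1)[OF F]]) auto
    hence "((\<lambda>z. c * F (d * z)) has_field_derivative c * (deriv F (d * z) * d)) (at z)"
      by (intro DERIV_cmult DERIV_chain2[where f = F]) (auto intro!: derivative_eq_intros)
    thus ?thesis
      using bloch_classD(2)[OF F norm_dz] assms by (simp add: DERIV_imp_deriv norm_mult)
  qed
  ultimately show ?thesis by (simp add: bloch_class_def)
qed

lemma bloch_sum_rotate: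
  assumes "F holomorphic_on ball 0 1" "norm c = 1" "norm d = 1"
  shows "bloch_sum (\<lambda>z. c * F (d * z)) r = bloch_sum F r"
proof -
  have "norm (taylor_coeff (\<lambda>z. c * F (d * z)) k) = norm (taylor_coeff F k)" for k
    using assms by (subst taylor_coeff_scale[OF assms(1)]) (auto simp: norm_mult norm_power)
  thus ?thesis by (simp add: bloch_sum_def)
qed

definition normalized_deriv :: "(complex \<Rightarrow> complex) \<Rightarrow> complex \<Rightarrow> complex" where
  "normalized_deriv F Z = 2 / 3 * deriv F (Z / of_real (sqrt 3))"

lemma norm_div_sqrt_3_less_1: "norm Z < sqrt 3 \<Longrightarrow> norm (Z / of_real (sqrt 3) :: complex) < 1"
  by (simp add: norm_divide)

lemma holomorphic_normalized_deriv:
  assumes "F \<in> bloch_class"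
  shows "normalized_deriv F holomorphic_on ball 0 (sqrt 3)"
  unfolding normalized_deriv_def
  using bloch_classD(1)[OF assms] norm_div_sqrt_3_less_1
  by (intro holomorphic_intros holomorphic_on_compose_gen[of _ _ "deriv F" "ball 0 1", unfolded o_def]
      holomorphic_deriv) auto

lemma holomorphic_normalized_deriv_unit_disc:
  assumes "F \<in> bloch_class"
  shows "normalized_deriv F holomorphic_on ball 0 1"
  by (rule holomorphic_on_subset[OF holomorphic_normalized_deriv[OF assms]]) (simp add: subset_ball)

lemma norm_normalized_deriv_le:
  assumes F: "F \<in> bloch_class" and Z: "norm Z < sqrt 3"
  shows "norm (normalized_deriv F Z) \<le> 2 / (3 - (norm Z)\<^sup>2)"
proof -
  have "(norm Z)\<^sup>2 < 3" using power_strict_mono[OF Z, of 2] by simp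
  have "norm (normalized_deriv F Z) = 2 / 3 * norm (deriv F (Z / of_real (sqrt 3)))"
    by (simp add: normalized_deriv_def norm_mult)
  also have "\<dots> \<le> 2 / 3 * (1 / (1 - (norm (Z / of_real (sqrt 3)))\<^sup>2))"
    using bloch_classD(2)[OF F norm_div_sqrt_3_less_1[OF Z]] by (intro mult_left_mono) auto
  also have "\<dots> = 2 / (3 - (norm Z)\<^sup>2)"
    using \<open>(norm Z)\<^sup>2 < 3\<close> by (simp add: norm_divide power_divide field_simps)
  finally show ?thesis .
qed

lemma norm_normalized_deriv_less_1:
  assumes "F \<in> bloch_class" "norm Z < 1"
  shows "norm (normalized_deriv F Z) < 1"
proof -
  have "1 < sqrt 3" by simp
  hence "norm Z < sqrt 3" using assms(2) by linarith
  from norm_normalized_deriv_le[OF assms(1) this]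
  have "norm (normalized_deriv F Z) \<le> 2 / (3 - (norm Z)\<^sup>2)" .
  also have "\<dots> < 1"
    using assms(2) abs_square_less_1[of "norm Z"] by (simp add: divide_less_eq)
  finally show ?thesis .
qed

lemma taylor_coeff_normalized_deriv:
  assumes "F \<in> bloch_class"
  shows "taylor_coeff (normalized_deriv F) k
      = 2 / 3 * (1 / of_real (sqrt 3)) ^ k * of_nat (Suc k) * taylor_coeff F (Suc k)"
proof -
  have "deriv F holomorphic_on ball 0 1"
    using bloch_classD(1)[OF assms] by (intro holomorphic_deriv) auto
  from taylor_coeff_scale[OF this, of "1 / of_real (sqrt 3)" "2 / 3"] show ?thesis
    by (simp add: normalized_deriv_def[abs_def] taylor_coeff_Suc del: of_nat_Suc)
qed

lemma sum_taylor_coeff_normalized_deriv_le_1: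
  assumes "F \<in> bloch_class"
  shows "(\<Sum>k<n. (norm (taylor_coeff (normalized_deriv F) k))\<^sup>2) \<le> 1"
proof -
  have "(\<Sum>k<n. (norm (taylor_coeff (normalized_deriv F) k))\<^sup>2 * 1 ^ (2 * k)) \<le> 1\<^sup>2"
  proof (rule taylor_coeff_bessel[OF holomorphic_normalized_deriv[OF assms]])
    fix Z :: complex assume "norm Z = 1"
    thus "norm (normalized_deriv F Z) \<le> 1" using norm_normalized_deriv_le[OF assms, of Z] by simp
  qed simp_all
  thus ?thesis by simp
qed

lemma norm_sqrt_3_mult_square: "(norm (complex_of_real (sqrt 3 * q)))\<^sup>2 = 3 * q\<^sup>2"
  by (simp only: norm_of_real power2_abs power_mult_distrib) simp

lemma norm_sqrt_3_mult_less_1: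
  assumes "3 * q\<^sup>2 < 1"
  shows "norm (complex_of_real (sqrt 3 * q)) < 1"
  using assms abs_square_less_1[of "norm (complex_of_real (sqrt 3 * q))"]
  unfolding norm_sqrt_3_mult_square by simp

lemma normalized_deriv_comp_Moebius_function:
  fixes q :: real
  assumes F: "F \<in> bloch_class" and q: "3 * q\<^sup>2 < 1" and Z: "norm Z < sqrt 3"
  shows "normalized_deriv F Z =
    normalized_deriv (F \<circ> Moebius_function 0 (- of_real (sqrt 3 * q)))
        ((Z - 3 * of_real q) / (1 - of_real q * Z))
      * (of_real (1 - 3 * q\<^sup>2) / (1 - of_real q * Z)\<^sup>2)"
proof -
  define p where "p = complex_of_real (sqrt 3 * q)"
  define H where "H = F \<circ> Moebius_function 0 (-p)"
  define z where "z = Z / of_real (sqrt 3)"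
  have norm_p_square: "(norm p)\<^sup>2 = 3 * q\<^sup>2" unfolding p_def by (rule norm_sqrt_3_mult_square)
  have p: "norm p < 1" unfolding p_def by (rule norm_sqrt_3_mult_less_1[OF q])
  have z: "norm z < 1" unfolding z_def by (rule norm_div_sqrt_3_less_1[OF Z])
  have cnj_p_mult_z: "cnj p * z = of_real q * Z" by (simp add: p_def z_def)
  have "H holomorphic_on ball 0 1"
    unfolding H_def using p by (intro bloch_classD(1) bloch_class_comp_Moebius_function F) simp
  have "F w = (H \<circ> Moebius_function 0 p) w" if "w \<in> ball 0 1" for w
    using that p by (simp add: H_def Moebius_function_compose)
  hence "deriv F z = deriv (H \<circ> Moebius_function 0 p) z"
    using z by (intro deriv_cong_ev eventually_nhds_in_open[THEN eventually_mono, of "ball 0 1"]) auto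
  also have "\<dots> = deriv H (Moebius_function 0 p z) * (of_real (1 - (norm p)\<^sup>2) / (1 - cnj p * z)\<^sup>2)"
    by (rule deriv_comp_Moebius_function[OF \<open>H holomorphic_on ball 0 1\<close> p z])
  also have "Moebius_function 0 p z = (Z - 3 * of_real q) / (1 - of_real q * Z) / of_real (sqrt 3)"
  proof -
    have "of_real (sqrt 3) * p = of_real (sqrt 3 * sqrt 3 * q)"
      by (simp only: p_def of_real_mult mult.assoc)
    hence "3 * of_real q = of_real (sqrt 3) * p" by simp
    thus ?thesis
      unfolding Moebius_function_simple cnj_p_mult_z by (simp add: z_def diff_divide_distrib)
  qed
  finally show ?thesis
    unfolding norm_p_square cnj_p_mult_z by (simp only: normalized_deriv_def H_def p_def z_def mult.assoc)
qed

section \<open>Comparison with the competitor\<close>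

locale normalized_bloch =
  fixes F :: "complex \<Rightarrow> complex" and q e :: real
  assumes F: "F \<in> bloch_class"
    and q: "0 \<le> q" "q < 1 / 3"
    and coeff_0: "taylor_coeff (normalized_deriv F) 0 = - of_real (3 * q * (1 - 3 * q\<^sup>2))"
    and coeff_1: "taylor_coeff (normalized_deriv F) 1
      = of_real ((1 - 3 * q\<^sup>2) * (1 - 9 * q\<^sup>2) - (1 - 3 * q\<^sup>2)\<^sup>2 * e)"
begin

definition K :: real where "K = 1 - 3 * q\<^sup>2"

lemma q_square: "0 \<le> q\<^sup>2" "q\<^sup>2 < 1 / 9"
  using q power_strict_mono[of q "1/3" 2] by (auto simp: power_divide)

lemma K_bounds: "2 / 3 < K" "K \<le> 1"
  using q_square by (auto simp: K_def)

lemma one_minus_qZ_nonzero: "1 - of_real q * Z \<noteq> 0" if "norm Z < 3" for Z :: complex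
proof
  assume "1 - of_real q * Z = 0"
  hence "norm (of_real q * Z) = 1" by simp
  hence "q * norm Z = 1" using q by (simp add: norm_mult)
  moreover have "q * norm Z \<le> 1 / 3 * norm Z" using q by (intro mult_right_mono) auto
  ultimately show False using that by simp
qed

definition translate :: "complex \<Rightarrow> complex" where
  "translate Z = (Z - 3 * of_real q) / (1 - of_real q * Z)"

definition self_map :: "complex \<Rightarrow> complex" where
  "self_map = normalized_deriv (F \<circ> Moebius_function 0 (- of_real (sqrt 3 * q)))"

lemma normalized_deriv_eq_self_map:
  assumes "norm Z < sqrt 3"
  shows "normalized_deriv F Z = self_map (translate Z) * (of_real K / (1 - of_real q * Z)\<^sup>2)"
  unfolding self_map_def translate_def K_def
  using assms q_square by (intro normalized_deriv_comp_Moebius_function F) auto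

lemma holomorphic_self_map: "self_map holomorphic_on ball 0 1"
  and norm_self_map_less_1: "norm W < 1 \<Longrightarrow> norm (self_map W) < 1"
proof -
  have "norm (- complex_of_real (sqrt 3 * q)) < 1"
    unfolding norm_minus_cancel using q_square by (intro norm_sqrt_3_mult_less_1) simp
  hence transported: "F \<circ> Moebius_function 0 (- of_real (sqrt 3 * q)) \<in> bloch_class"
    by (rule bloch_class_comp_Moebius_function[OF F])
  show "self_map holomorphic_on ball 0 1"
    unfolding self_map_def by (rule holomorphic_normalized_deriv_unit_disc[OF transported])
  show "norm (self_map W) < 1" if "norm W < 1"
    unfolding self_map_def by (rule norm_normalized_deriv_less_1[OF transported that])
qed

lemma translate_0: "translate 0 = - of_real (3 * q)"
  by (simp add: translate_def)

lemma self_map_fixed_point: "self_map (- of_real (3 * q)) = - of_real (3 * q)"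
proof -
  have "self_map (- of_real (3 * q)) * of_real K = - of_real (3 * q) * of_real K"
    using normalized_deriv_eq_self_map[of 0] coeff_0
    by (simp add: taylor_coeff_0 translate_0 flip: K_def)
  moreover have "complex_of_real K \<noteq> 0" using K_bounds by simp
  ultimately show ?thesis by (metis mult_right_cancel)
qed

lemma norm_fixed_point: "norm (- complex_of_real (3 * q)) = 3 * q"
  using q by (simp only: norm_minus_cancel norm_of_real)

lemma deriv_self_map_fixed_point: "deriv self_map (- of_real (3 * q)) = of_real (1 - e)"
proof -
  define D where "D = deriv self_map (- of_real (3 * q))"
  have self_map_deriv: "(self_map has_field_derivative D) (at (- of_real (3 * q)))"
    unfolding D_def using norm_fixed_point q by (intro holomorphic_derivI[OF holomorphic_self_map]) auto
  have "(translate has_field_derivative of_real K) (at 0)"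
    unfolding translate_def[abs_def] by (auto intro!: derivative_eq_intros simp: K_def power2_eq_square)
  hence "((\<lambda>Z. self_map (translate Z)) has_field_derivative D * of_real K) (at 0)"
    using self_map_deriv by (intro DERIV_chain2[where f = self_map]) (simp_all only: translate_0)
  moreover have "((\<lambda>Z. of_real K / (1 - of_real q * Z)\<^sup>2) has_field_derivative
      of_real (2 * q * K)) (at 0)"
    by (auto intro!: derivative_eq_intros)
  ultimately have "((\<lambda>Z. self_map (translate Z) * (of_real K / (1 - of_real q * Z)\<^sup>2))
      has_field_derivative D * of_real K * of_real K - of_real (3 * q) * of_real (2 * q * K)) (at 0)"
    using self_map_fixed_point by (auto intro!: derivative_eq_intros simp: translate_0)
  from DERIV_imp_deriv[OF this]
  have "deriv (normalized_deriv F) 0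
      = D * of_real K * of_real K - of_real (3 * q) * of_real (2 * q * K)"
    by (subst deriv_cong_ev[OF eventually_nhds_in_open[THEN eventually_mono, of "ball 0 (sqrt 3)"]])
      (simp_all add: normalized_deriv_eq_self_map)
  moreover have "deriv (normalized_deriv F) 0 = of_real (K * (1 - 9 * q\<^sup>2) - K\<^sup>2 * e)"
    using coeff_1 by (simp add: taylor_coeff_def K_def)
  ultimately have "D * of_real (K\<^sup>2)
      = of_real (K * (1 - 9 * q\<^sup>2) - K\<^sup>2 * e) + of_real (3 * q) * of_real (2 * q * K)"
    by (simp only: of_real_power power2_eq_square of_real_mult diff_add_cancel mult.assoc)
  also have "\<dots> = of_real (K * (1 - 9 * q\<^sup>2) - K\<^sup>2 * e + 3 * q * (2 * q * K))"
    by (simp only: of_real_add of_real_mult)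
  also have "K * (1 - 9 * q\<^sup>2) - K\<^sup>2 * e + 3 * q * (2 * q * K) = (1 - e) * K\<^sup>2"
    by (simp add: K_def power2_eq_square algebra_simps)
  finally have "D * of_real (K\<^sup>2) = of_real (1 - e) * of_real (K\<^sup>2)" by (simp only: of_real_mult)
  thus ?thesis using K_bounds by (simp add: D_def)
qed

lemma e_nonneg: "0 \<le> e"
proof -
  have "norm (deriv self_map (- of_real (3 * q))) \<le> 1"
    using q norm_fixed_point
    by (intro norm_deriv_fixed_point_le_1 holomorphic_self_map norm_self_map_less_1 self_map_fixed_point)
      auto
  hence "\<bar>1 - e\<bar> \<le> 1" unfolding deriv_self_map_fixed_point norm_of_real .
  thus ?thesis by simp
qed

definition competitor :: "complex \<Rightarrow> complex" where
  "competitor Z = translate Z * (of_real K / (1 - of_real q * Z)\<^sup>2)"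

definition deviation :: "complex \<Rightarrow> complex" where
  "deviation Z = normalized_deriv F Z - competitor Z"

lemma deviation_eq:
  assumes "norm Z < sqrt 3"
  shows "deviation Z = (self_map (translate Z) - translate Z) * (of_real K / (1 - of_real q * Z)\<^sup>2)"
  using assms
  by (simp only: deviation_def competitor_def normalized_deriv_eq_self_map left_diff_distrib)

lemma translate_eq_Moebius_function:
  assumes Z: "norm Z < 1" and v: "norm v < 1"
    and v_eq: "v * (1 - 9 * of_real q ^ 2 + 2 * of_real q * Z) = of_real K * Z"
  shows "translate Z = Moebius_function 0 (of_real (3 * q)) v"
proof -
  define a where "a = complex_of_real q"
  have cnj_a: "cnj a = a" by (simp add: a_def)
  have "of_real K = 1 - 3 * a\<^sup>2" by (simp add: K_def a_def)
  hence cross: "(Z - 3 * a) * (1 - 3 * a * v) = (v - 3 * a) * (1 - a * Z)"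
    using v_eq unfolding a_def[symmetric] by algebra
  have "1 - a * Z \<noteq> 0"
    using one_minus_qZ_nonzero[of Z] Z by (simp add: a_def)
  moreover have "1 - 3 * a * v \<noteq> 0"
    using one_minus_qZ_nonzero[of "3 * v"] v by (simp add: a_def norm_mult mult_ac)
  ultimately show ?thesis
    using cross
    by (simp add: translate_def Moebius_function_simple divide_eq_eq eq_divide_eq cnj_a flip: a_def)
qed

lemma translate_bounds:
  assumes Z: "norm Z \<le> r" "r < 1"
    and V: "r \<le> V * (1 - 9 * q\<^sup>2 - 2 * q * r)" "0 < V" "V < 1"
  shows "norm (translate Z) < 1" "norm (Moebius_function 0 (- of_real (3 * q)) (translate Z)) \<le> V"
proof -
  define B where "B = 1 - 9 * of_real q ^ 2 + 2 * of_real q * Z"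
  define v where "v = of_real K * Z / B"
  have r: "0 \<le> r" using Z norm_ge_zero[of Z] by linarith
  have denom_pos: "0 < 1 - 9 * q\<^sup>2 - 2 * q * r"
  proof (cases "r = 0")
    case False
    with r V have "0 < V * (1 - 9 * q\<^sup>2 - 2 * q * r)" by linarith
    thus ?thesis using V(2) by (simp add: zero_less_mult_iff)
  qed (use q_square in simp)
  have "norm (complex_of_real (1 - 9 * q\<^sup>2)) = 1 - 9 * q\<^sup>2"
    unfolding norm_of_real using q_square by simp
  moreover have "norm (2 * of_real q * Z) \<le> 2 * q * r"
    using Z q by (simp add: norm_mult mult_left_mono)
  ultimately have norm_B_ge: "1 - 9 * q\<^sup>2 - 2 * q * r \<le> norm B"
    using norm_triangle_ineq2[of "of_real (1 - 9 * q\<^sup>2)" "- (2 * of_real q * Z)"] by (simp add: B_def)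
  have "norm v = K * norm Z / norm B"
    using K_bounds by (simp add: v_def norm_mult norm_divide)
  also have "\<dots> \<le> 1 * r / (1 - 9 * q\<^sup>2 - 2 * q * r)"
    using K_bounds Z r norm_B_ge denom_pos by (intro frac_le mult_mono) auto
  also have "\<dots> \<le> V" using V(1) denom_pos by (simp add: pos_divide_le_eq)
  finally have norm_v_le: "norm v \<le> V" .
  have "v * B = of_real K * Z" using norm_B_ge denom_pos by (auto simp: v_def)
  hence translate_eq: "translate Z = Moebius_function 0 (of_real (3 * q)) v"
    unfolding B_def using Z norm_v_le V(3) by (intro translate_eq_Moebius_function) auto
  show "norm (translate Z) < 1"
    unfolding translate_eq using norm_v_le V(3) q norm_fixed_point by (intro Moebius_function_norm_lt_1) auto
  have "Moebius_function 0 (- of_real (3 * q)) (translate Z) = v"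
    unfolding translate_eq using norm_v_le V(3) q norm_fixed_point by (intro Moebius_function_compose) auto
  thus "norm (Moebius_function 0 (- of_real (3 * q)) (translate Z)) \<le> V" using norm_v_le by simp
qed

lemma norm_deviation_le:
  assumes Z: "norm Z \<le> r" "r < 1"
    and V: "r \<le> V * (1 - 9 * q\<^sup>2 - 2 * q * r)" "0 < V" "V < 1"
  shows "norm (deviation Z) \<le> V * (1 + V) / ((1 - V) * (1 - q * r)\<^sup>2 * (1 - 3 * q * V)\<^sup>2) * e"
proof -
  have "norm (self_map (translate Z) - translate Z)
      \<le> (1 - (3 * q)\<^sup>2) * (V * (e * ((1 + V) / (1 - V)))) / (1 - 3 * q * V)\<^sup>2"
    using norm_self_map_minus_id_le[OF holomorphic_self_map norm_self_map_less_1 _ self_map_fixed_point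
        translate_bounds[OF Z V] V(3)] q e_nonneg
    unfolding norm_fixed_point deriv_self_map_fixed_point by simp
  also have "\<dots> \<le> 1 * (V * (e * ((1 + V) / (1 - V)))) / (1 - 3 * q * V)\<^sup>2"
    using V e_nonneg by (intro divide_right_mono mult_right_mono) auto
  finally have self_map_le: "norm (self_map (translate Z) - translate Z)
      \<le> V * (e * ((1 + V) / (1 - V))) / (1 - 3 * q * V)\<^sup>2" by simp
  have "1 < sqrt 3" by simp
  hence "norm Z < sqrt 3" using Z by linarith
  hence "norm (deviation Z)
      = norm (self_map (translate Z) - translate Z) * (K / (norm (1 - of_real q * Z))\<^sup>2)"
    using K_bounds by (simp add: deviation_eq norm_mult norm_divide norm_power)
  also have "\<dots> \<le> V * (e * ((1 + V) / (1 - V))) / (1 - 3 * q * V)\<^sup>2 * (1 / (1 - q * r)\<^sup>2)"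
  proof (intro mult_mono frac_le power_mono self_map_le)
    have "0 \<le> r" using Z norm_ge_zero[of Z] by linarith
    hence "q * r < 1" using mult_strict_mono[of q 1 r 1] q Z by simp
    thus "0 \<le> 1 - q * r" "0 < (1 - q * r)\<^sup>2" by simp_all
    show "1 - q * r \<le> norm (1 - of_real q * Z)"
      using norm_triangle_ineq2[of 1 "of_real q * Z"] mult_left_mono[OF Z(1), of q] q
      by (simp add: norm_mult)
  qed (use K_bounds V e_nonneg in simp_all)
  also have "\<dots> = V * (1 + V) / ((1 - V) * (1 - q * r)\<^sup>2 * (1 - 3 * q * V)\<^sup>2) * e"
    by (simp add: mult_ac)
  finally show ?thesis .
qed

lemma q_le_of_square_le: "q \<le> 71 / 1000" if "q\<^sup>2 \<le> 1 / 200"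
  using that by (intro power2_le_imp_le[of q "71 / 1000"]) (simp_all add: power_divide)

lemma norm_deviation_le_of_square_le:
  assumes small: "q\<^sup>2 \<le> 1 / 200" and Z: "norm Z \<le> r" "r < 1"
    and V: "r \<le> V * (191 / 200 - 71 / 500 * r)" "0 < V" "V < 1"
  shows "norm (deviation Z)
      \<le> V * (1 + V) / ((1 - V) * (1 - 71 / 1000 * r)\<^sup>2 * (1 - 213 / 1000 * V)\<^sup>2) * e"
proof -
  note q_le = q_le_of_square_le[OF small]
  have r: "0 \<le> r" using Z(1) norm_ge_zero[of Z] by linarith
  have q_mult_r_le: "q * r \<le> 71 / 1000 * r" and q_mult_V_le: "q * V \<le> 71 / 1000 * V"
    using mult_right_mono[OF q_le r] mult_right_mono[OF q_le less_imp_le[OF V(2)]] by simp_all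
  have "191 / 200 - 71 / 500 * r \<le> 1 - 9 * q\<^sup>2 - 2 * q * r" using small q_mult_r_le by simp
  hence "r \<le> V * (1 - 9 * q\<^sup>2 - 2 * q * r)"
    using V by (meson mult_left_mono less_imp_le order_trans)
  hence "norm (deviation Z) \<le> V * (1 + V) / ((1 - V) * (1 - q * r)\<^sup>2 * (1 - 3 * q * V)\<^sup>2) * e"
    by (intro norm_deviation_le Z V)
  also have "\<dots> \<le> V * (1 + V) / ((1 - V) * (1 - 71 / 1000 * r)\<^sup>2 * (1 - 213 / 1000 * V)\<^sup>2) * e"
    using q_mult_r_le q_mult_V_le Z V e_nonneg by (intro mult_right_mono frac_le mult_mono power_mono) auto
  finally show ?thesis .
qed

lemma norm_deviation_le_on_two_thirds:
  assumes "q\<^sup>2 \<le> 1 / 200" "norm Z \<le> 2 / 3"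
  shows "norm (deviation Z) \<le> 10 * e"
  using norm_deviation_le_of_square_le[OF assms, of "775 / 1000"] e_nonneg
  by (simp add: power2_eq_square)

lemma norm_deviation_le_on_half:
  assumes "q\<^sup>2 \<le> 1 / 200" "norm Z \<le> 1 / 2"
  shows "norm (deviation Z) \<le> 3 * e"
  using norm_deviation_le_of_square_le[OF assms, of "57 / 100"] e_nonneg
  by (simp add: power2_eq_square)

text \<open>
  The competitor is its second Taylor polynomial plus \<open>Z^3\<close> times a cofactor, so that a bound on the
  deviation from it bounds the coefficient of \<open>Z^2\<close> without an error of order \<open>q^2\<close>.
\<close>

definition competitor_quadratic :: "complex \<Rightarrow> complex" where
  "competitor_quadratic Z = - of_real (3 * q * K) + of_real (K * (1 - 9 * q\<^sup>2)) * Z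
      + of_real (3 * q * K * (1 - 6 * q\<^sup>2)) * Z\<^sup>2"

definition competitor_cofactor :: "complex \<Rightarrow> complex" where
  "competitor_cofactor Z = of_real (K * q\<^sup>2) *
     (of_real (6 - 30 * q\<^sup>2) - of_real (q * (8 - 45 * q\<^sup>2)) * Z + of_real (q\<^sup>2 * (3 - 18 * q\<^sup>2)) * Z\<^sup>2)
     / (1 - of_real q * Z) ^ 3"

lemma competitor_split:
  assumes "norm Z < 1"
  shows "competitor Z = competitor_quadratic Z + Z ^ 3 * competitor_cofactor Z"
proof -
  define a where "a = complex_of_real q"
  define P where "P = - 3 * a + (1 - 9 * a\<^sup>2) * Z + 3 * a * (1 - 6 * a\<^sup>2) * Z\<^sup>2"
  define N where "N = a\<^sup>2 * (6 - 30 * a\<^sup>2 - a * (8 - 45 * a\<^sup>2) * Z + a\<^sup>2 * (3 - 18 * a\<^sup>2) * Z\<^sup>2)"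
  have "1 - a * Z \<noteq> 0"
    using one_minus_qZ_nonzero[of Z] assms by (simp add: a_def)
  have "Z - 3 * a = P * (1 - a * Z) ^ 3 + Z ^ 3 * N"
    unfolding P_def N_def by algebra
  hence "of_real K * (Z - 3 * a) / (1 - a * Z) ^ 3
      = of_real K * P + Z ^ 3 * (of_real K * N / (1 - a * Z) ^ 3)"
    using \<open>1 - a * Z \<noteq> 0\<close> by (simp add: distrib_left add_divide_distrib mult.left_commute)
  moreover have "competitor Z = of_real K * (Z - 3 * a) / (1 - a * Z) ^ 3"
    by (simp add: competitor_def translate_def a_def power2_eq_square power3_eq_cube mult.commute)
  moreover have "competitor_quadratic Z = of_real K * P"
    by (simp add: competitor_quadratic_def P_def a_def algebra_simps)
  moreover have "competitor_cofactor Z = of_real K * N / (1 - a * Z) ^ 3"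
    by (simp add: competitor_cofactor_def N_def a_def mult.assoc)
  ultimately show ?thesis by simp
qed

lemma norm_competitor_remainder_le:
  assumes small: "q\<^sup>2 \<le> 1 / 200" and Z: "norm Z \<le> 2 / 3"
  shows "norm (Z ^ 3 * competitor_cofactor Z) \<le> 3 * q\<^sup>2"
proof -
  note q_le = q_le_of_square_le[OF small]
  define N where "N = of_real (6 - 30 * q\<^sup>2) - of_real (q * (8 - 45 * q\<^sup>2)) * Z
      + of_real (q\<^sup>2 * (3 - 18 * q\<^sup>2)) * Z\<^sup>2"
  have "norm N \<le> norm (complex_of_real (6 - 30 * q\<^sup>2)) + norm (of_real (q * (8 - 45 * q\<^sup>2)) * Z)
      + norm (of_real (q\<^sup>2 * (3 - 18 * q\<^sup>2)) * Z\<^sup>2)"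
    unfolding N_def by (meson add_right_mono norm_triangle_ineq norm_triangle_ineq4 order_trans)
  also have "\<dots> = (6 - 30 * q\<^sup>2) + q * (8 - 45 * q\<^sup>2) * norm Z + q\<^sup>2 * (3 - 18 * q\<^sup>2) * (norm Z)\<^sup>2"
    unfolding norm_mult norm_power norm_of_real using q small by (simp add: abs_mult)
  also have "\<dots> \<le> 6 + 71 / 1000 * 8 * (2 / 3) + 1 / 200 * 3 * (2 / 3)\<^sup>2"
    using q small q_le Z by (intro add_mono mult_mono power_mono) auto
  also have "\<dots> \<le> 7" by (simp add: power_divide)
  finally have norm_N_le: "norm N \<le> 7" .
  have "q * norm Z \<le> 71 / 1000 * (2 / 3)" using q q_le Z by (intro mult_mono) auto
  hence "95 / 100 \<le> norm (1 - of_real q * Z)"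
    using norm_triangle_ineq2[of 1 "of_real q * Z"] q by (simp add: norm_mult)
  hence denom_ge: "(95 / 100) ^ 3 \<le> norm (1 - of_real q * Z) ^ 3" by (intro power_mono) auto
  have "norm (Z ^ 3 * competitor_cofactor Z)
      = norm Z ^ 3 * (K * q\<^sup>2 * norm N / norm (1 - of_real q * Z) ^ 3)"
    unfolding competitor_cofactor_def N_def[symmetric] norm_mult norm_divide norm_power norm_of_real
    using K_bounds q by simp
  also have "\<dots> \<le> (2 / 3) ^ 3 * (1 * q\<^sup>2 * 7 / (95 / 100) ^ 3)"
    using norm_N_le denom_ge K_bounds Z q by (intro mult_mono frac_le power_mono) auto
  also have "\<dots> \<le> 3 * q\<^sup>2" by (simp add: power_divide)
  finally show ?thesis .
qed

lemma holomorphic_deviation: "deviation holomorphic_on ball 0 1"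
  and holomorphic_competitor_cofactor: "competitor_cofactor holomorphic_on ball 0 1"
proof -
  have nonzero: "1 - of_real q * Z \<noteq> 0" if "Z \<in> ball 0 1" for Z :: complex
    using that one_minus_qZ_nonzero by simp
  show "deviation holomorphic_on ball 0 1"
    unfolding deviation_def competitor_def translate_def
    using nonzero holomorphic_normalized_deriv_unit_disc[OF F] by (intro holomorphic_intros) auto
  show "competitor_cofactor holomorphic_on ball 0 1"
    unfolding competitor_cofactor_def using nonzero by (intro holomorphic_intros) auto
qed

lemma taylor_coeff_normalized_deriv_split:
  "taylor_coeff (normalized_deriv F) k = taylor_coeff competitor_quadratic k
    + taylor_coeff (\<lambda>Z. deviation Z + Z ^ 3 * competitor_cofactor Z) k"
proof -
  have "competitor_quadratic holomorphic_on ball 0 1"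
    unfolding competitor_quadratic_def by (intro holomorphic_intros)
  moreover have "(\<lambda>Z. deviation Z + Z ^ 3 * competitor_cofactor Z) holomorphic_on ball 0 1"
    by (intro holomorphic_intros holomorphic_deviation holomorphic_competitor_cofactor)
  moreover have "taylor_coeff (normalized_deriv F) k =
      taylor_coeff (\<lambda>Z. competitor_quadratic Z + (deviation Z + Z ^ 3 * competitor_cofactor Z)) k"
    unfolding taylor_coeff_def
    by (intro arg_cong2[where f = "(/)"] refl higher_deriv_cong_ev
        eventually_nhds_in_open[THEN eventually_mono, of "ball 0 1"])
      (auto simp: deviation_def competitor_split)
  ultimately show ?thesis by (simp add: taylor_coeff_add[of _ "ball 0 1"])
qed

lemma norm_coeff_2_le:
  assumes "q\<^sup>2 \<le> 1 / 200"
  shows "norm (taylor_coeff (normalized_deriv F) 2) \<le> 3 * q * K + 12 * e"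
proof -
  have "norm (taylor_coeff deviation 2) \<le> 3 * e / (1 / 2)\<^sup>2"
    using norm_deviation_le_on_half[OF assms]
    by (intro norm_taylor_coeff_le[OF holomorphic_deviation]) auto
  hence deviation_2: "norm (taylor_coeff deviation 2) \<le> 12 * e"
    by (simp add: power2_eq_square)
  have "taylor_coeff (\<lambda>Z. deviation Z + Z ^ 3 * competitor_cofactor Z) 2 = taylor_coeff deviation 2"
    using taylor_coeff_mult_power_eq_0[OF holomorphic_competitor_cofactor, of 2 3]
    by (subst taylor_coeff_add[of _ "ball 0 1"])
      (auto intro!: holomorphic_intros holomorphic_deviation holomorphic_competitor_cofactor)
  hence "taylor_coeff (normalized_deriv F) 2
      = of_real (3 * q * K * (1 - 6 * q\<^sup>2)) + taylor_coeff deviation 2"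
    unfolding taylor_coeff_normalized_deriv_split competitor_quadratic_def[abs_def] taylor_coeff_quadratic
    by simp
  also have "norm \<dots> \<le> \<bar>3 * q * K * (1 - 6 * q\<^sup>2)\<bar> + 12 * e"
    using deviation_2 by (intro norm_triangle_le) (simp only: norm_of_real add_left_mono)
  also have "\<bar>3 * q * K * (1 - 6 * q\<^sup>2)\<bar> \<le> 3 * q * K"
    using q assms K_bounds by (simp add: abs_mult mult_left_le)
  finally show ?thesis by simp
qed

lemma sum_coeff_tail_le:
  assumes small: "q\<^sup>2 \<le> 1 / 200"
  shows "(\<Sum>k=3..<n. (norm (taylor_coeff (normalized_deriv F) k))\<^sup>2 * (4 / 9) ^ k)
      \<le> (10 * e + 3 * q\<^sup>2)\<^sup>2"
proof -
  define f where "f Z = deviation Z + Z ^ 3 * competitor_cofactor Z" for Z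
  have "(\<Sum>k=3..<n. (norm (taylor_coeff (normalized_deriv F) k))\<^sup>2 * (4 / 9) ^ k)
      = (\<Sum>k=3..<n. (norm (taylor_coeff f k))\<^sup>2 * (2 / 3) ^ (2 * k))"
    unfolding taylor_coeff_normalized_deriv_split competitor_quadratic_def[abs_def]
      taylor_coeff_quadratic f_def[abs_def]
    by (intro sum.cong) (auto simp: power_mult power_divide)
  also have "\<dots> \<le> (\<Sum>k<n. (norm (taylor_coeff f k))\<^sup>2 * (2 / 3) ^ (2 * k))"
    by (intro sum_mono2) auto
  also have "\<dots> \<le> (10 * e + 3 * q\<^sup>2)\<^sup>2"
  proof (rule taylor_coeff_bessel)
    show "f holomorphic_on ball 0 1"
      unfolding f_def
      by (intro holomorphic_intros holomorphic_deviation holomorphic_competitor_cofactor)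
    fix Z :: complex assume "norm Z = 2 / 3"
    thus "norm (f Z) \<le> 10 * e + 3 * q\<^sup>2"
      unfolding f_def
      using norm_deviation_le_on_two_thirds[OF small] norm_competitor_remainder_le[OF small]
      by (intro norm_triangle_mono) auto
  qed auto
  finally show ?thesis .
qed

end

section \<open>Weighted sums of squares\<close>

definition area_sum :: "(nat \<Rightarrow> real) \<Rightarrow> nat \<Rightarrow> real \<Rightarrow> real" where
  "area_sum c N s = (\<Sum>k<N. (c k)\<^sup>2 * s ^ k / real (Suc k))"

lemma convex_on_area_sum: "convex_on {0..} (area_sum c N)"
proof -
  have "convex_on {0..} (\<lambda>s. (c k)\<^sup>2 / real (Suc k) * s ^ k)" for k
    using convex_power_odd[of k] convex_on_subset[OF convex_power_even[of k], of "{0..}"]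
    by (cases "even k") (auto intro!: convex_on_cmul)
  hence "convex_on {0..} (\<lambda>s. \<Sum>k<N. (c k)\<^sup>2 / real (Suc k) * s ^ k)"
    by (induction N) (auto simp: convex_on_const simp del: of_nat_Suc)
  thus ?thesis by (simp add: area_sum_def[abs_def])
qed

lemma area_sum_le_head_plus_tail:
  assumes tail: "\<And>n. (\<Sum>k=m..<n. (c k)\<^sup>2 * t ^ k) \<le> T" and s: "0 \<le> s" "s \<le> t" "0 < t"
  shows "area_sum c N s \<le> area_sum c m s + (s / t) ^ m / real (Suc m) * T"
proof -
  define n where "n = max m N"
  have "area_sum c N s \<le> area_sum c n s"
    unfolding area_sum_def using s by (intro sum_mono2) (auto simp: n_def)
  also have "\<dots> = area_sum c m s + (\<Sum>k=m..<n. (c k)\<^sup>2 * s ^ k / real (Suc k))"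
    unfolding area_sum_def
    by (subst sum.atLeastLessThan_concat[of 0 m n, symmetric, unfolded atLeast0LessThan])
      (auto simp: n_def)
  also have "(\<Sum>k=m..<n. (c k)\<^sup>2 * s ^ k / real (Suc k))
      \<le> (\<Sum>k=m..<n. (s / t) ^ m / real (Suc m) * ((c k)\<^sup>2 * t ^ k))"
  proof (rule sum_mono)
    fix k assume "k \<in> {m..<n}"
    hence "(s / t) ^ k / real (Suc k) \<le> (s / t) ^ m / real (Suc m)"
      using s by (intro frac_le power_decreasing) auto
    from mult_right_mono[OF this, of "(c k)\<^sup>2 * t ^ k"] s
    show "(c k)\<^sup>2 * s ^ k / real (Suc k) \<le> (s / t) ^ m / real (Suc m) * ((c k)\<^sup>2 * t ^ k)"
      by (simp add: power_divide mult_ac)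
  qed
  also have "\<dots> \<le> (s / t) ^ m / real (Suc m) * T"
    unfolding sum_distrib_left[symmetric] using s tail by (intro mult_left_mono) auto
  finally show ?thesis by simp
qed

section \<open>The inequality for coefficient sequences\<close>

definition critical_s :: real where
  "critical_s = (59 - sqrt 2713) / 16"

lemma critical_s_square: "critical_s\<^sup>2 = (59 * critical_s - 24) / 8"
proof -
  have "sqrt 2713 * sqrt 2713 = 2713" by simp
  thus ?thesis unfolding critical_s_def power2_eq_square by (simp add: field_simps)
qed

lemma critical_s_bounds: "432 / 1000 \<le> critical_s" "critical_s \<le> 4321 / 10000"
proof -
  have "sqrt 2713 \<le> 52088 / 1000" by (rule real_le_lsqrt) (auto simp: power2_eq_square)
  thus "432 / 1000 \<le> critical_s" by (simp add: critical_s_def)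
  have "520864 / 10000 \<le> sqrt 2713" by (rule real_le_rsqrt) (auto simp: power2_eq_square)
  thus "critical_s \<le> 4321 / 10000" by (simp add: critical_s_def)
qed

lemma competitor_deficit:
  fixes Q :: real
  assumes "0 \<le> Q" "Q \<le> 4 / 9"
  shows "(8 / 3 - 6 * Q) * (9 * Q * (1 - 3 * Q)\<^sup>2) \<le> 1 - ((1 - 3 * Q) * (1 - 9 * Q))\<^sup>2"
proof -
  have "1 - ((1 - 3 * Q) * (1 - 9 * Q))\<^sup>2 - (8 / 3 - 6 * Q) * (9 * Q * (1 - 3 * Q)\<^sup>2)
      = 27 * Q ^ 3 * (4 - 9 * Q)"
    by algebra
  moreover have "0 \<le> 27 * Q ^ 3 * (4 - 9 * Q)" using assms by simp
  ultimately show ?thesis by linarith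
qed

locale coefficient_bounds =
  fixes c :: "nat \<Rightarrow> real" and Q e :: real
  assumes sum_squares_le_1: "(\<Sum>k<n. (c k)\<^sup>2) \<le> 1"
    and Q: "0 \<le> Q" "Q < 1 / 9" and e: "0 \<le> e"
    and c_nonneg: "0 \<le> c k"
    and c0_square: "(c 0)\<^sup>2 = 9 * Q * (1 - 3 * Q)\<^sup>2"
    and c1_eq: "c 1 = (1 - 3 * Q) * (1 - 9 * Q) - (1 - 3 * Q)\<^sup>2 * e"
    and c2_le: "Q \<le> 1 / 200 \<Longrightarrow> c 2 \<le> c 0 + 12 * e"
    and tail_le: "Q \<le> 1 / 200 \<Longrightarrow> (\<Sum>k=3..<n. (c k)\<^sup>2 * (4 / 9) ^ k) \<le> (10 * e + 3 * Q)\<^sup>2"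
begin

definition u :: real where "u = (c 0)\<^sup>2"

lemma u_eq: "u = 9 * Q * (1 - 3 * Q)\<^sup>2"
  by (simp add: u_def c0_square)

lemma one_minus_u_eq: "1 - 9 / 4 * u = (1 - 9 * Q)\<^sup>2 * (1 - 9 / 4 * Q)"
  unfolding u_eq by algebra

lemma u_bounds: "0 \<le> u" "9 / 4 * u \<le> 1" "u \<le> 9 * Q" "9 * Q * (1 - 6 * Q) \<le> u"
proof -
  show "0 \<le> u" by (simp add: u_def)
  have "0 \<le> (1 - 9 * Q)\<^sup>2 * (1 - 9 / 4 * Q)" using Q by simp
  thus "9 / 4 * u \<le> 1" using one_minus_u_eq by linarith
  have "(1 - 3 * Q)\<^sup>2 \<le> 1\<^sup>2" using Q by (intro power_mono) auto
  thus "u \<le> 9 * Q" using Q by (simp add: u_eq mult_left_le)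
  have "1 - 6 * Q \<le> (1 - 3 * Q)\<^sup>2"
    using zero_le_power2[of "3 * Q"] by (simp add: power2_diff)
  thus "9 * Q * (1 - 6 * Q) \<le> u" using Q by (simp add: u_eq mult_left_mono)
qed

lemma c1_square_le:
  assumes "0 \<le> d" "d \<le> (1 - 3 * Q)\<^sup>2 * e"
  shows "(c 1)\<^sup>2 \<le> 1 - (8 / 3 - 6 * Q) * u - d * (2 * (1 - 12 * Q) - d)"
proof -
  define g where "g = (1 - 3 * Q) * (1 - 9 * Q)"
  have "1 - 12 * Q \<le> g" by (simp add: g_def algebra_simps)
  hence "d * (2 * (1 - 12 * Q) - d) \<le> d * (2 * g - d)"
    using assms by (intro mult_left_mono) auto
  moreover have "(c 1)\<^sup>2 \<le> (g - d)\<^sup>2"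
    using assms c_nonneg[of 1] c1_eq unfolding g_def by (intro power_mono) linarith+
  moreover have "(8 / 3 - 6 * Q) * u \<le> 1 - g\<^sup>2"
    unfolding u_eq g_def using Q by (intro competitor_deficit) auto
  moreover have "(g - d)\<^sup>2 = g\<^sup>2 - d * (2 * g - d)" by algebra
  ultimately show ?thesis by linarith
qed

lemma area_sum_le_two_coefficients:
  assumes "0 < s" "s \<le> 1"
  shows "area_sum c N s \<le> u + s / 2 * (c 1)\<^sup>2 + s\<^sup>2 / 3 * (1 - u - (c 1)\<^sup>2)"
proof -
  have "(\<Sum>k=2..<n. (c k)\<^sup>2 * 1 ^ k) \<le> 1 - u - (c 1)\<^sup>2" for n
  proof -
    have "(\<Sum>k<2. (c k)\<^sup>2) + (\<Sum>k=2..<max 2 n. (c k)\<^sup>2) \<le> 1"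
      using sum.atLeastLessThan_concat[of 0 2 "max 2 n" "\<lambda>k. (c k)\<^sup>2"] sum_squares_le_1[of "max 2 n"]
      by (simp add: atLeast0LessThan)
    moreover have "(\<Sum>k=2..<n. (c k)\<^sup>2) \<le> (\<Sum>k=2..<max 2 n. (c k)\<^sup>2)"
      by (intro sum_mono2) auto
    ultimately show ?thesis by (simp add: u_def numeral_2_eq_2)
  qed
  from area_sum_le_head_plus_tail[where t = 1, OF this, of s N] assms show ?thesis
    by (simp add: area_sum_def u_def numeral_2_eq_2 mult_ac)
qed

lemma area_sum_le_of_deficit:
  assumes s: "0 < s" "s \<le> 1" and deficit: "\<tau> * u \<le> 1 - (c 1)\<^sup>2"
    and weighted_le: "(1 - s\<^sup>2 / 3 - (s / 2 - s\<^sup>2 / 3) * \<tau>) * (1 - 9 / 4 * u) \<le> 9 / 8 * s"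
  shows "(1 - 9 / 4 * u) * area_sum c N s \<le> s / 2"
proof -
  define w where "w = s / 2 - s\<^sup>2 / 3"
  have w_nonneg: "0 \<le> w" using s by (simp add: w_def power2_eq_square mult_left_le)
  have "u + s / 2 * (c 1)\<^sup>2 + s\<^sup>2 / 3 * (1 - u - (c 1)\<^sup>2)
      = s / 2 + (1 - s\<^sup>2 / 3) * u - w * (1 - (c 1)\<^sup>2)"
    by (simp add: w_def field_simps)
  also have "\<dots> \<le> s / 2 + (1 - s\<^sup>2 / 3 - w * \<tau>) * u"
    using mult_left_mono[OF deficit w_nonneg] by (simp add: algebra_simps)
  finally have "area_sum c N s \<le> s / 2 + (1 - s\<^sup>2 / 3 - w * \<tau>) * u"
    using area_sum_le_two_coefficients[OF s, of N] by linarith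
  hence "(1 - 9 / 4 * u) * area_sum c N s \<le> (1 - 9 / 4 * u) * (s / 2 + (1 - s\<^sup>2 / 3 - w * \<tau>) * u)"
    using u_bounds by (intro mult_left_mono) auto
  also have "\<dots> = s / 2 + ((1 - s\<^sup>2 / 3 - w * \<tau>) * (1 - 9 / 4 * u) - 9 / 8 * s) * u"
    by (simp add: field_simps)
  also have "\<dots> \<le> s / 2"
    using weighted_le u_bounds unfolding w_def[symmetric] by (simp add: mult_nonpos_nonneg)
  finally show ?thesis .
qed

lemma area_sum_at_one: "(1 - 9 / 4 * u) * area_sum c N 1 \<le> 1 / 2"
proof (rule area_sum_le_of_deficit[where \<tau> = 0])
  have "u + (c 1)\<^sup>2 \<le> 1"
    using sum_squares_le_1[of 2] by (simp add: u_def numeral_2_eq_2)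
  thus "0 * u \<le> 1 - (c 1)\<^sup>2" using u_bounds(1) by simp
qed (use u_bounds in auto)

lemma area_sum_at_critical_large_Q:
  assumes "1 / 200 \<le> Q"
  shows "(1 - 9 / 4 * u) * area_sum c N critical_s \<le> critical_s / 2"
proof (rule area_sum_le_of_deficit[where \<tau> = "8 / 3 - 6 * Q"])
  let ?s = critical_s and ?w = "critical_s / 2 - critical_s\<^sup>2 / 3"
  show "(8 / 3 - 6 * Q) * u \<le> 1 - (c 1)\<^sup>2"
    using c1_square_le[of 0] e by simp
  have "?w \<le> 154 / 1000" "1 - ?s\<^sup>2 / 3 - 8 / 3 * ?w \<le> 528 / 1000"
    using critical_s_bounds critical_s_square by (simp_all add: field_simps)
  hence "1 - ?s\<^sup>2 / 3 - ?w * (8 / 3 - 6 * Q) \<le> 528 / 1000 * (1 + 7 / 4 * Q)"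
    using mult_right_mono[of ?w "154 / 1000" Q] Q by (simp add: algebra_simps)
  hence "(1 - ?s\<^sup>2 / 3 - ?w * (8 / 3 - 6 * Q)) * (1 - 9 / 4 * u)
      \<le> 528 / 1000 * (1 + 7 / 4 * Q) * (1 - 9 / 4 * u)"
    using u_bounds by (intro mult_right_mono) auto
  also have "\<dots> = 528 / 1000 * ((1 - 9 * Q)\<^sup>2 * ((1 + 7 / 4 * Q) * (1 - 9 / 4 * Q)))"
    unfolding one_minus_u_eq by (simp only: mult_ac)
  also have "\<dots> \<le> 528 / 1000 * ((1 - 9 / 200)\<^sup>2 * 1)"
  proof (intro mult_left_mono mult_mono power_mono)
    have "(1 + 7 / 4 * Q) * (1 - 9 / 4 * Q) = 1 - (Q / 2 + 63 / 16 * Q\<^sup>2)"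
      by (simp add: field_simps power2_eq_square)
    also have "\<dots> \<le> 1 - 0" using Q by (intro diff_left_mono add_nonneg_nonneg) auto
    finally show "(1 + 7 / 4 * Q) * (1 - 9 / 4 * Q) \<le> 1" by simp
  qed (use Q assms in auto)
  also have "\<dots> \<le> 9 / 8 * ?s" using critical_s_bounds by (simp add: power2_eq_square)
  finally show "(1 - ?s\<^sup>2 / 3 - ?w * (8 / 3 - 6 * Q)) * (1 - 9 / 4 * u) \<le> 9 / 8 * ?s" .
qed (use critical_s_bounds in auto)

lemma area_sum_at_critical_large_defect:
  assumes Q_le: "Q \<le> 1 / 200" and "4 / 3 * Q \<le> e"
  shows "(1 - 9 / 4 * u) * area_sum c N critical_s \<le> critical_s / 2"
proof (rule area_sum_le_of_deficit[where \<tau> = "80 / 27 - 10 * Q"])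
  let ?s = critical_s and ?w = "critical_s / 2 - critical_s\<^sup>2 / 3"
  define d where "d = 4 / 27 * u" \<comment> \<open>the value of \<open>(1 - 3 * Q)\<^sup>2 * e\<close> at \<open>e = 4 / 3 * Q\<close>\<close>
  have "d \<le> (1 - 3 * Q)\<^sup>2 * e"
    using mult_left_mono[OF assms(2), of "(1 - 3 * Q)\<^sup>2"] by (simp add: d_def u_eq mult_ac)
  hence "(c 1)\<^sup>2 \<le> 1 - (8 / 3 - 6 * Q) * u - d * (2 * (1 - 12 * Q) - d)"
    using u_bounds by (intro c1_square_le) (auto simp: d_def)
  moreover have "d * (2 - 76 / 3 * Q) \<le> d * (2 * (1 - 12 * Q) - d)"
    using u_bounds by (intro mult_left_mono) (auto simp: d_def)
  moreover have "d * (2 - 76 / 3 * Q) = 8 / 27 * u - 304 / 81 * (Q * u)"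
    by (simp add: d_def algebra_simps)
  moreover have "0 \<le> Q * u" using Q u_bounds by simp
  ultimately show "(80 / 27 - 10 * Q) * u \<le> 1 - (c 1)\<^sup>2"
    by (simp add: left_diff_distrib)
  have "?w \<le> 154 / 1000" "1 - ?s\<^sup>2 / 3 - 80 / 27 * ?w \<le> 4825 / 10000"
    using critical_s_bounds critical_s_square by (simp_all add: field_simps)
  hence "1 - ?s\<^sup>2 / 3 - ?w * (80 / 27 - 10 * Q) \<le> 4825 / 10000 * (1 + 4 * Q)"
    using mult_right_mono[of ?w "154 / 1000" Q] Q by (simp add: algebra_simps)
  hence "(1 - ?s\<^sup>2 / 3 - ?w * (80 / 27 - 10 * Q)) * (1 - 9 / 4 * u)
      \<le> 4825 / 10000 * (1 + 4 * Q) * (1 - 9 / 4 * u)"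
    using u_bounds by (intro mult_right_mono) auto
  also have "1 - 9 / 4 * u \<le> 1 - 4 * Q"
    using u_bounds(4) Q mult_left_mono[OF Q_le, of Q] by (simp add: algebra_simps)
  hence "4825 / 10000 * (1 + 4 * Q) * (1 - 9 / 4 * u) \<le> 4825 / 10000 * (1 + 4 * Q) * (1 - 4 * Q)"
    using Q by (intro mult_left_mono) auto
  also have "\<dots> = 4825 / 10000 * (1 - 16 * Q\<^sup>2)" by (simp add: power2_eq_square field_simps)
  also have "\<dots> \<le> 4825 / 10000" by simp
  also have "\<dots> \<le> 9 / 8 * ?s" using critical_s_bounds by simp
  finally show "(1 - ?s\<^sup>2 / 3 - ?w * (80 / 27 - 10 * Q)) * (1 - 9 / 4 * u) \<le> 9 / 8 * ?s" .
qed (use critical_s_bounds in auto)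

lemma c1_square_le_small:
  assumes "Q \<le> 1 / 200" "e \<le> 4 / 3 * Q"
  shows "(c 1)\<^sup>2 \<le> 1 - (8 / 3 - 6 * Q) * u - 181 / 100 * e"
proof -
  define d where "d = 97 / 100 * e"
  have "(97 / 100 :: real) \<le> (1 - 3 / 200)\<^sup>2" by (simp add: power2_eq_square)
  also have "\<dots> \<le> (1 - 3 * Q)\<^sup>2" using assms by (intro power_mono) auto
  finally have "d \<le> (1 - 3 * Q)\<^sup>2 * e" unfolding d_def using e by (rule mult_right_mono)
  hence "(c 1)\<^sup>2 \<le> 1 - (8 / 3 - 6 * Q) * u - d * (2 * (1 - 12 * Q) - d)"
    using e by (intro c1_square_le) (auto simp: d_def)
  moreover have "d * (1873 / 1000) \<le> d * (2 * (1 - 12 * Q) - d)"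
    using assms e by (intro mult_left_mono) (auto simp: d_def)
  ultimately show ?thesis using e by (simp add: d_def)
qed

lemma c2_square_le_small:
  assumes "Q \<le> 1 / 200" "e \<le> 4 / 3 * Q"
  shows "(c 2)\<^sup>2 \<le> u + 61 / 10 * e"
proof -
  have "(c 0)\<^sup>2 \<le> (2125 / 10000)\<^sup>2"
    using u_bounds(3) assms by (simp add: u_def power2_eq_square)
  hence "c 0 \<le> 2125 / 10000" by (rule power2_le_imp_le) simp
  hence "c 0 * e \<le> 2125 / 10000 * e" using e by (intro mult_right_mono)
  moreover have "e * e \<le> 1 / 150 * e" using assms e by (intro mult_right_mono) auto
  moreover have "(c 2)\<^sup>2 \<le> (c 0 + 12 * e)\<^sup>2" using c2_le assms c_nonneg by (intro power_mono) auto
  moreover have "(c 0 + 12 * e)\<^sup>2 = u + 24 * (c 0 * e) + 144 * (e * e)"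
    by (simp add: u_def power2_eq_square algebra_simps)
  ultimately show ?thesis using e by linarith
qed

lemma area_sum_le_three_coefficients:
  assumes "Q \<le> 1 / 200" "e \<le> 4 / 3 * Q" "0 \<le> s" "s \<le> 4 / 9"
  shows "area_sum c N s \<le> u + s / 2 * (c 1)\<^sup>2 + s\<^sup>2 / 3 * (c 2)\<^sup>2 + 67 * Q\<^sup>2"
proof -
  have "(s / (4 / 9)) ^ 3 \<le> 1"
    using assms by (intro power_le_one) auto
  have "area_sum c N s \<le> area_sum c 3 s + (s / (4 / 9)) ^ 3 / real (Suc 3) * (10 * e + 3 * Q)\<^sup>2"
    using assms by (intro area_sum_le_head_plus_tail tail_le) auto
  also have "(s / (4 / 9)) ^ 3 / real (Suc 3) * (10 * e + 3 * Q)\<^sup>2 \<le> 1 / 4 * (49 / 3 * Q)\<^sup>2"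
    using assms \<open>(s / (4 / 9)) ^ 3 \<le> 1\<close> Q e by (intro mult_mono power_mono) auto
  also have "1 / 4 * (49 / 3 * Q)\<^sup>2 \<le> 67 * Q\<^sup>2" by (simp add: power_mult_distrib power_divide)
  also have "area_sum c 3 s = u + s / 2 * (c 1)\<^sup>2 + s\<^sup>2 / 3 * (c 2)\<^sup>2"
    by (simp add: area_sum_def u_def eval_nat_numeral mult_ac)
  finally show ?thesis by simp
qed

lemma second_order_terms_le:
  assumes "Q \<le> 1 / 200"
  shows "3 * critical_s * (Q * u) + 67 * Q\<^sup>2 \<le> 81 / 32 * critical_s * u\<^sup>2"
proof -
  have "critical_s * (Q * u) \<le> 4321 / 10000 * (Q * (9 * Q))"
    using critical_s_bounds u_bounds Q by (intro mult_mono) auto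
  hence "3 * critical_s * (Q * u) \<le> 12 * Q\<^sup>2"
    using zero_le_square[of Q] unfolding power2_eq_square by linarith
  moreover have "87 / 10 * Q \<le> u"
    using u_bounds(4) mult_left_mono[OF assms Q(1)] Q(1) by (simp add: algebra_simps)
  hence "432 / 1000 * (87 / 10 * Q)\<^sup>2 \<le> critical_s * u\<^sup>2"
    using critical_s_bounds Q by (intro mult_mono power_mono) auto
  moreover have "32 * Q\<^sup>2 \<le> 432 / 1000 * (87 / 10 * Q)\<^sup>2"
    by (simp add: power_mult_distrib power_divide)
  ultimately show ?thesis using zero_le_power2[of Q] by linarith
qed

lemma area_sum_at_critical_small:
  assumes small: "Q \<le> 1 / 200" "e \<le> 4 / 3 * Q"
  shows "(1 - 9 / 4 * u) * area_sum c N critical_s \<le> critical_s / 2"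
proof -
  let ?s = critical_s and ?x = "9 / 4 * u"
  note s = critical_s_bounds
  have "area_sum c N ?s \<le> u + ?s / 2 * (c 1)\<^sup>2 + ?s\<^sup>2 / 3 * (c 2)\<^sup>2 + 67 * Q\<^sup>2"
    using small s by (intro area_sum_le_three_coefficients) auto
  also have "\<dots> \<le> u + ?s / 2 * (1 - (8 / 3 - 6 * Q) * u - 181 / 100 * e)
      + ?s\<^sup>2 / 3 * (u + 61 / 10 * e) + 67 * Q\<^sup>2"
    using c1_square_le_small[OF small] c2_square_le_small[OF small] s
    by (intro add_mono mult_left_mono) auto
  also have "\<dots> = u + ?s / 2 - 4 / 3 * ?s * u + ?s\<^sup>2 / 3 * u
      + (3 * ?s * (Q * u) + 67 * Q\<^sup>2) - (181 / 200 - 61 / 30 * ?s) * ?s * e"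
    by (simp add: field_simps power2_eq_square)
  also have "\<dots> \<le> u + ?s / 2 - 4 / 3 * ?s * u + ?s\<^sup>2 / 3 * u + 81 / 32 * ?s * u\<^sup>2"
  proof -
    have "0 \<le> (181 / 200 - 61 / 30 * ?s) * ?s * e" using s e by simp
    thus ?thesis using second_order_terms_le[OF small(1)] by linarith
  qed
  \<comment> \<open>\<open>critical_s\<close> is the root at which the terms linear in \<open>u\<close> match.\<close>
  also have "\<dots> = ?s / 2 * (1 + ?x + ?x\<^sup>2)"
    unfolding critical_s_square by (simp add: field_simps power2_eq_square)
  finally have "(1 - ?x) * area_sum c N ?s \<le> (1 - ?x) * (?s / 2 * (1 + ?x + ?x\<^sup>2))"
    using u_bounds by (intro mult_left_mono) auto
  also have "\<dots> = ?s / 2 * (1 - ?x ^ 3)"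
    by (simp add: field_simps power2_eq_square power3_eq_cube)
  also have "\<dots> \<le> ?s / 2"
    using s u_bounds by (simp add: mult_left_le)
  finally show ?thesis .
qed

lemma area_sum_le:
  assumes "critical_s \<le> s" "s \<le> 1"
  shows "(1 - 9 / 4 * u) * area_sum c N s \<le> s / 2"
proof -
  define f where "f s = (1 - 9 / 4 * u) * area_sum c N s - s / 2" for s
  have "convex_on {critical_s..1} f"
    unfolding f_def[abs_def] using u_bounds critical_s_bounds
    by (intro convex_on_diff convex_on_cmul convex_on_subset[OF convex_on_area_sum] concave_on_cdiv)
      (auto simp: concave_on_ident)
  moreover have "f critical_s \<le> 0"
    unfolding f_def
    using area_sum_at_critical_large_Q area_sum_at_critical_large_defect area_sum_at_critical_small
    by (metis diff_le_0_iff_le nle_le)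
  moreover have "f 1 \<le> 0"
    using area_sum_at_one by (simp add: f_def)
  ultimately have "f s \<le> 0"
    using convex_on_le_max[of critical_s 1 f s] assms by simp
  thus ?thesis by (simp add: f_def)
qed

end

section \<open>The coefficient inequality for Bloch functions\<close>

lemma norm_taylor_coeff_Suc:
  assumes "F \<in> bloch_class"
  shows "norm (taylor_coeff F (Suc k))
    = 3 / 2 * sqrt 3 ^ k / real (Suc k) * norm (taylor_coeff (normalized_deriv F) k)"
  unfolding taylor_coeff_normalized_deriv[OF assms]
  by (simp add: norm_mult norm_power norm_divide power_divide del: of_nat_Suc)

lemma bloch_sum_term_eq:
  assumes "F \<in> bloch_class"
  shows "real (Suc k) * (norm (taylor_coeff F (Suc k)))\<^sup>2 * r ^ (2 * Suc k)
    = 9 / 4 * r\<^sup>2 * ((norm (taylor_coeff (normalized_deriv F) k))\<^sup>2 * (3 * r\<^sup>2) ^ k / real (Suc k))"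
proof -
  have "(sqrt 3 ^ k)\<^sup>2 = 3 ^ k" by (simp add: power2_eq_square flip: power_mult_distrib)
  thus ?thesis
    unfolding norm_taylor_coeff_Suc[OF assms]
    by (simp add: power_mult_distrib power_divide power_mult power2_eq_square del: of_nat_Suc)
qed

lemma bloch_sum_le_of_area_sum_le:
  assumes F: "F \<in> bloch_class"
  defines "c \<equiv> \<lambda>k. norm (taylor_coeff (normalized_deriv F) k)"
  assumes area_le: "\<And>N. (1 - 9 / 4 * (c 0)\<^sup>2) * area_sum c N (3 * r\<^sup>2) \<le> 3 * r\<^sup>2 / 2"
    and c0_square_less: "9 / 4 * (c 0)\<^sup>2 < 1"
  shows "bloch_sum F r \<le> 27 / 8 * r ^ 4"
proof -
  define t where "t k = real (Suc k) * (norm (taylor_coeff F (Suc k)))\<^sup>2 * r ^ (2 * Suc k)" for k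
  define D where "D = 1 - 9 / 4 * (c 0)\<^sup>2"
  have "0 < D" using c0_square_less by (simp add: D_def)
  have t_eq: "t k = 9 / 4 * r\<^sup>2 * ((c k)\<^sup>2 * (3 * r\<^sup>2) ^ k / real (Suc k))" for k
    unfolding t_def c_def by (rule bloch_sum_term_eq[OF F])
  have partial_sum_le: "(\<Sum>k<N. t k) \<le> 27 / 8 * r ^ 4 / D" for N
  proof -
    have "(\<Sum>k<N. t k) * D = 9 / 4 * r\<^sup>2 * (D * area_sum c N (3 * r\<^sup>2))"
      by (simp add: t_eq area_sum_def sum_distrib_left mult_ac)
    also have "\<dots> \<le> 9 / 4 * r\<^sup>2 * (3 * r\<^sup>2 / 2)"
      using area_le unfolding D_def by (intro mult_left_mono) auto
    also have "\<dots> = 27 / 8 * r ^ 4" by (simp add: power4_eq_xxxx power2_eq_square)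
    finally show ?thesis using \<open>0 < D\<close> by (simp only: pos_le_divide_eq)
  qed
  have "0 \<le> t k" for k
    unfolding t_def by (intro mult_nonneg_nonneg zero_le_even_power) auto
  hence "summable t" using partial_sum_le by (rule summableI_nonneg_bounded)
  hence "suminf t \<le> 27 / 8 * r ^ 4 / D" using partial_sum_le by (rule suminf_le_const)
  moreover have "norm (taylor_coeff F 1) = 3 / 2 * c 0"
    using norm_taylor_coeff_Suc[OF F, of 0] by (simp add: c_def)
  hence "bloch_sum F r = suminf t * D"
    unfolding bloch_sum_def
    by (simp only: t_def[abs_def] D_def power_mult_distrib) (simp add: power_divide)
  ultimately show ?thesis using \<open>0 < D\<close> by (simp only: pos_le_divide_eq)
qed

lemma exists_competitor_parameter:
  fixes a :: real
  assumes "0 \<le> a" "a < 2 / 3"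
  obtains q where "0 \<le> q" "q < 1 / 3" "3 * q * (1 - 3 * q\<^sup>2) = a"
proof -
  have "\<exists>q\<ge>0. q \<le> 1 / 3 \<and> 3 * q * (1 - 3 * q\<^sup>2) = a"
    using assms by (intro IVT') (auto intro!: continuous_intros simp: power2_eq_square)
  then obtain q where q: "0 \<le> q" "q \<le> 1 / 3" "3 * q * (1 - 3 * q\<^sup>2) = a" by blast
  moreover have "q \<noteq> 1 / 3"
  proof
    assume "q = 1 / 3"
    with q(3) assms show False by (simp add: power2_eq_square)
  qed
  ultimately show thesis using that by simp
qed

lemma bloch_sum_le_normalized:
  assumes F: "F \<in> bloch_class"
    and coeff_0: "taylor_coeff (normalized_deriv F) 0 = - of_real a" and a: "0 \<le> a" "a < 2 / 3"
    and coeff_1: "taylor_coeff (normalized_deriv F) 1 = of_real b" and b: "0 \<le> b"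
    and r: "critical_s \<le> 3 * r\<^sup>2" "3 * r\<^sup>2 \<le> 1"
  shows "bloch_sum F r \<le> 27 / 8 * r ^ 4"
proof -
  obtain q where q: "0 \<le> q" "q < 1 / 3" and a_eq: "3 * q * (1 - 3 * q\<^sup>2) = a"
    using exists_competitor_parameter a by blast
  have q_square: "q\<^sup>2 < 1 / 9" using q power_strict_mono[of q "1/3" 2] by (auto simp: power_divide)
  define e where "e = ((1 - 3 * q\<^sup>2) * (1 - 9 * q\<^sup>2) - b) / (1 - 3 * q\<^sup>2)\<^sup>2"
  have b_eq: "(1 - 3 * q\<^sup>2) * (1 - 9 * q\<^sup>2) - (1 - 3 * q\<^sup>2)\<^sup>2 * e = b"
    using q_square by (simp add: e_def)
  define c where "c k = norm (taylor_coeff (normalized_deriv F) k)" for k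
  have c_0: "c 0 = a" and c_1: "c 1 = b"
    unfolding c_def coeff_0 coeff_1 using a b by simp_all
  interpret normalized_bloch F q e
    using F q coeff_0 coeff_1 by unfold_locales (simp_all only: a_eq b_eq)
  interpret coefficient_bounds c "q\<^sup>2" e
  proof
    show "(c 0)\<^sup>2 = 9 * q\<^sup>2 * (1 - 3 * q\<^sup>2)\<^sup>2"
      unfolding c_0 a_eq[symmetric] by (simp add: power_mult_distrib)
    show "c 2 \<le> c 0 + 12 * e" if "q\<^sup>2 \<le> 1 / 200"
      using norm_coeff_2_le[OF that] unfolding c_0 a_eq[symmetric] by (simp add: c_def K_def)
  qed (use q_square e_nonneg sum_taylor_coeff_normalized_deriv_le_1[OF F] sum_coeff_tail_le c_1 b_eq
      in \<open>simp_all add: c_def\<close>)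
  show ?thesis
  proof (rule bloch_sum_le_of_area_sum_le[OF F, folded c_def])
    show "(1 - 9 / 4 * (c 0)\<^sup>2) * area_sum c N (3 * r\<^sup>2) \<le> 3 * r\<^sup>2 / 2" for N
      using area_sum_le[OF r] by (simp add: u_def)
    have "a\<^sup>2 < (2 / 3)\<^sup>2" using a by (intro power_strict_mono) auto
    thus "9 / 4 * (c 0)\<^sup>2 < 1" by (simp add: c_0 power_divide)
  qed
qed

lemma exists_unimodular_rotation:
  fixes z :: complex
  obtains c where "norm c = 1" "c * z = of_real (norm z)"
proof (cases "z = 0")
  case False
  have "norm (cnj (sgn z)) = 1" using False by (simp add: norm_sgn)
  moreover have "cnj (sgn z) * z = of_real (norm z)"
    using False by (simp add: sgn_eq complex_norm_square[symmetric] mult.commute power2_eq_square)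
  ultimately show thesis by (rule that)
qed (use that[of 1] in simp)

lemma normalizing_rotation:
  assumes F: "F \<in> bloch_class"
  obtains G where "G \<in> bloch_class" "\<And>r. bloch_sum G r = bloch_sum F r"
    "taylor_coeff (normalized_deriv G) 0 = - of_real (norm (taylor_coeff (normalized_deriv F) 0))"
    "taylor_coeff (normalized_deriv G) 1 = of_real (norm (taylor_coeff (normalized_deriv F) 1))"
proof -
  let ?b = "taylor_coeff (normalized_deriv F)"
  obtain \<alpha> where \<alpha>: "norm \<alpha> = 1" "\<alpha> * ?b 0 = of_real (norm (?b 0))"
    using exists_unimodular_rotation .
  obtain d where d: "norm d = 1" "d * (- \<alpha> * ?b 1) = of_real (norm (- \<alpha> * ?b 1))"
    using exists_unimodular_rotation .
  define c where "c = - \<alpha> / d"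
  have "d \<noteq> 0" using d(1) by auto
  have "norm c = 1" using \<alpha>(1) d(1) by (simp add: c_def norm_divide)
  define G where "G z = c * F (d * z)" for z
  have G_class: "G \<in> bloch_class"
    unfolding G_def[abs_def] by (rule bloch_class_rotate[OF F \<open>norm c = 1\<close> d(1)])
  have coeff: "taylor_coeff (normalized_deriv G) k = c * d ^ Suc k * ?b k" for k
    unfolding taylor_coeff_normalized_deriv[OF F] taylor_coeff_normalized_deriv[OF G_class]
    using taylor_coeff_scale[OF bloch_classD(1)[OF F] zero_less_one \<open>d \<noteq> 0\<close>]
    by (simp add: G_def[abs_def])
  show thesis
  proof (rule that[OF G_class])
    show "bloch_sum G r = bloch_sum F r" for r
      unfolding G_def[abs_def] by (rule bloch_sum_rotate[OF bloch_classD(1)[OF F] \<open>norm c = 1\<close> d(1)])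
    show "taylor_coeff (normalized_deriv G) 0 = - of_real (norm (?b 0))"
      using \<alpha>(2) \<open>d \<noteq> 0\<close> by (simp add: coeff c_def)
    show "taylor_coeff (normalized_deriv G) 1 = of_real (norm (?b 1))"
      using d(2) \<alpha>(1) \<open>d \<noteq> 0\<close> by (simp add: coeff c_def norm_mult mult_ac)
  qed
qed

lemma bloch_sum_le:
  assumes F: "F \<in> bloch_class" and r: "critical_s \<le> 3 * r\<^sup>2" "3 * r\<^sup>2 \<le> 1"
  shows "bloch_sum F r \<le> 27 / 8 * r ^ 4"
proof (cases "norm (taylor_coeff F 1) = 1")
  case True
  then show ?thesis by (simp add: bloch_sum_def)
next
  case False
  have "norm (taylor_coeff F 1) \<le> 1"
    using bloch_classD(2)[OF F, of 0] by (simp add: taylor_coeff_def)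
  hence "norm (taylor_coeff (normalized_deriv F) 0) < 2 / 3"
    unfolding taylor_coeff_normalized_deriv[OF F] using False by (simp add: norm_mult)
  thus ?thesis
    using normalizing_rotation[OF F] bloch_sum_le_normalized r by (metis norm_ge_zero)
qed

section \<open>Sharpness\<close>

lemma quadratic_in_bloch_class: "(\<lambda>z. complex_of_real (3 * sqrt 3 / 4) * z ^ 2) \<in> bloch_class"
proof -
  have deriv_eq: "deriv (\<lambda>z. complex_of_real (3 * sqrt 3 / 4) * z ^ 2) z
      = of_real (3 * sqrt 3 / 2) * z" for z
    by (rule DERIV_imp_deriv) (auto intro!: derivative_eq_intros)
  have "norm (complex_of_real (3 * sqrt 3 / 2) * z) \<le> 1 / (1 - (norm z)\<^sup>2)" if z: "z \<in> ball 0 1" for z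
  proof -
    define x where "x = sqrt 3 * norm z"
    have "0 \<le> (x - 1)\<^sup>2 * (x + 2)" by (intro mult_nonneg_nonneg) (auto simp: x_def)
    moreover have "(x - 1)\<^sup>2 * (x + 2) = x * x\<^sup>2 - 3 * x + 2"
      by (simp add: power2_eq_square algebra_simps)
    moreover have "x\<^sup>2 = 3 * (norm z)\<^sup>2" by (simp add: x_def power_mult_distrib)
    ultimately have "3 / 2 * x * (1 - (norm z)\<^sup>2) \<le> 1" by (simp add: algebra_simps)
    moreover have "norm (complex_of_real (3 * sqrt 3 / 2) * z) = 3 / 2 * x"
      unfolding norm_mult norm_of_real by (simp add: x_def)
    moreover have "0 < 1 - (norm z)\<^sup>2" using z by (simp add: power_less_one_iff abs_square_less_1)
    ultimately show ?thesis by (simp add: pos_le_divide_eq)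
  qed
  thus ?thesis
    unfolding bloch_class_def mem_Collect_eq deriv_eq by (intro conjI ballI holomorphic_intros)
qed

lemma bloch_sum_quadratic: "bloch_sum (\<lambda>z. b * z ^ 2) r = 2 * (norm b)\<^sup>2 * r ^ 4"
proof -
  have "(\<Sum>k. real (Suc k) * (norm (taylor_coeff (\<lambda>z. b * z ^ 2) (Suc k)))\<^sup>2 * r ^ (2 * Suc k))
      = (\<Sum>k\<in>{1}. real (Suc k) * (norm (taylor_coeff (\<lambda>z. b * z ^ 2) (Suc k)))\<^sup>2 * r ^ (2 * Suc k))"
    by (rule suminf_finite) (auto simp: taylor_coeff_monom)
  thus ?thesis by (simp add: bloch_sum_def taylor_coeff_monom)
qed

lemma three_square_radius_bounds:
  assumes "1 / (4 * sqrt 3) * sqrt (59 - sqrt 2713) \<le> r" "r \<le> 1 / sqrt 3"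
  shows "critical_s \<le> 3 * r\<^sup>2" "3 * r\<^sup>2 \<le> 1"
proof -
  define R where "R = 1 / (4 * sqrt 3) * sqrt (59 - sqrt 2713)"
  have "0 \<le> 59 - sqrt 2713" using critical_s_bounds by (simp add: critical_s_def)
  hence R_nonneg: "0 \<le> R" and R_square: "3 * R\<^sup>2 = critical_s"
    by (simp_all add: R_def critical_s_def power_mult_distrib power_divide)
  have "R\<^sup>2 \<le> r\<^sup>2" "r\<^sup>2 \<le> (1 / sqrt 3)\<^sup>2"
    using assms R_nonneg unfolding R_def[symmetric] by (auto intro!: power_mono)
  thus "critical_s \<le> 3 * r\<^sup>2" "3 * r\<^sup>2 \<le> 1"
    using R_square by (simp_all add: power_divide)
qed

theorem theorem5:
  defines "R \<equiv> 1 / (4 * sqrt 3) * sqrt (59 - sqrt 2713)"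
  shows "(\<forall>F \<in> bloch_class. \<forall>r. R \<le> r \<and> r \<le> 1 / sqrt 3 \<longrightarrow>
            bloch_sum F r \<le> 27 / 8 * r ^ 4)
       \<and> (\<lambda>z. complex_of_real (3 * sqrt 3 / 4) * z ^ 2) \<in> bloch_class
       \<and> (\<forall>r. R \<le> r \<and> r \<le> 1 / sqrt 3 \<longrightarrow>
            bloch_sum (\<lambda>z. complex_of_real (3 * sqrt 3 / 4) * z ^ 2) r = 27 / 8 * r ^ 4)"
proof (intro conjI ballI allI impI)
  fix F r assume "F \<in> bloch_class" "R \<le> r \<and> r \<le> 1 / sqrt 3"
  thus "bloch_sum F r \<le> 27 / 8 * r ^ 4"
    using three_square_radius_bounds[of r] unfolding R_def by (intro bloch_sum_le) auto
next
  show "(\<lambda>z. complex_of_real (3 * sqrt 3 / 4) * z ^ 2) \<in> bloch_class"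
    by (rule quadratic_in_bloch_class)
next
  fix r
  have "(norm (complex_of_real (3 * sqrt 3 / 4)))\<^sup>2 = 27 / 16"
    unfolding norm_of_real by (simp add: power_divide power_mult_distrib)
  thus "bloch_sum (\<lambda>z. complex_of_real (3 * sqrt 3 / 4) * z ^ 2) r = 27 / 8 * r ^ 4"
    by (simp only: bloch_sum_quadratic)
qed

end
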